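(* Let $R$ be a finite Frobenius local ring with unity (not assumed commutative), with Jacobson radical $J(R)$ and residue field $\mathbb{F}_q=R/J(R)$, and let $\pi:R^n\to\mathbb{F}_q^n$ be componentwise reduction modulo $J(R)$. Let $C$ and $D$ be two free linear codes in $R^n$ (i.e. right $R$-submodules of $R^n$ that are free as right $R$-modules). Then the pair $(C,D)$ is LCP (in $R^n$) if and only if the pair $(\pi(C),\pi(D))$ is LCP (in $\mathbb{F}_q^n$).
   Context: A ring is local if its non-units form an additive abelian group; for a finite local ring $R$, $J(R)$ is the set of non-units and $R/J(R)$ is a finite field. A finite ring $R$ is Frobenius if it is right and left self-injective and $R/J(R)\cong \mathrm{Soc}(R)$ as right $R$-modules. A linear code of length $n$ over $R$ is a right $R$-submodule of $R^n$. A right $R$-module is free if it is isomorphic to $R^t$ for some integer $t\ge 0$. A pair $(C,D)$ of codes in $R^n$ is LCP (a linear complementary pair) if $C\oplus D=R^n$, i.e. $C+D=R^n$ and $C\cap D=\{0\}$; similarly, a pair of $\mathbb{F}_q$-subspaces of $\mathbb{F}_q^n$ is LCP if $\mathbb{F}_q^n$ is their direct sum. *)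

theory Defs
  imports "HOL-Algebra.QuotRing" "HOL-Algebra.Module"
begin

section \<open>Right modules over a ring that need not be commutative\<close>

text \<open>
  The locale \<open>module\<close> of HOL-Algebra requires a commutative ring. We reuse its record, but read
  \<open>r \<odot>\<^bsub>M\<^esub> x\<close> as the right action \<open>x \<cdot> r\<close>; this is what distinguishes \<open>smult_assoc\<close> below from
  the axiom for left modules. The fields \<open>mult\<close> and \<open>one\<close> of the record play no role.
  The library's \<open>submodule\<close> does not refer to the multiplication of the ring, so that
  \<open>submodule H R M\<close> is the notion of a right submodule when \<open>M\<close> is a right module.
\<close>

locale right_module = R?: ring R + M?: abelian_group M
  for R :: "('a, 'r) ring_scheme" (structure) and M :: "('a, 'b, 'm) module_scheme" (structure) +
  assumes smult_closed:
      "\<lbrakk>r \<in> carrier R; x \<in> carrier M\<rbrakk> \<Longrightarrow> r \<odot>\<^bsub>M\<^esub> x \<in> carrier M"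
    and smult_scalar_distr:
      "\<lbrakk>r \<in> carrier R; s \<in> carrier R; x \<in> carrier M\<rbrakk> \<Longrightarrow>
       (r \<oplus>\<^bsub>R\<^esub> s) \<odot>\<^bsub>M\<^esub> x = r \<odot>\<^bsub>M\<^esub> x \<oplus>\<^bsub>M\<^esub> s \<odot>\<^bsub>M\<^esub> x"
    and smult_vector_distr:
      "\<lbrakk>r \<in> carrier R; x \<in> carrier M; y \<in> carrier M\<rbrakk> \<Longrightarrow>
       r \<odot>\<^bsub>M\<^esub> (x \<oplus>\<^bsub>M\<^esub> y) = r \<odot>\<^bsub>M\<^esub> x \<oplus>\<^bsub>M\<^esub> r \<odot>\<^bsub>M\<^esub> y"
    and smult_assoc:
      "\<lbrakk>r \<in> carrier R; s \<in> carrier R; x \<in> carrier M\<rbrakk> \<Longrightarrow>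
       (r \<otimes>\<^bsub>R\<^esub> s) \<odot>\<^bsub>M\<^esub> x = s \<odot>\<^bsub>M\<^esub> (r \<odot>\<^bsub>M\<^esub> x)"
    and smult_one: "x \<in> carrier M \<Longrightarrow> \<one>\<^bsub>R\<^esub> \<odot>\<^bsub>M\<^esub> x = x"

definition rmod_hom ::
  "('a, 'r) ring_scheme \<Rightarrow> ('a, 'b, 'm) module_scheme \<Rightarrow> ('a, 'c, 'k) module_scheme \<Rightarrow> ('b \<Rightarrow> 'c) set"
  where "rmod_hom R M N = {h \<in> carrier M \<rightarrow> carrier N.
    (\<forall>x\<in>carrier M. \<forall>y\<in>carrier M. h (x \<oplus>\<^bsub>M\<^esub> y) = h x \<oplus>\<^bsub>N\<^esub> h y) \<and>
    (\<forall>r\<in>carrier R. \<forall>x\<in>carrier M. h (r \<odot>\<^bsub>M\<^esub> x) = r \<odot>\<^bsub>N\<^esub> h x)}"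

definition rmod_isomorphic ::
  "('a, 'r) ring_scheme \<Rightarrow> ('a, 'b, 'm) module_scheme \<Rightarrow> ('a, 'c, 'k) module_scheme \<Rightarrow> bool"
  where "rmod_isomorphic R M N \<longleftrightarrow> (\<exists>h\<in>rmod_hom R M N. bij_betw h (carrier M) (carrier N))"

definition right_regular :: "('a, 'r) ring_scheme \<Rightarrow> ('a, 'a) module"
  where "right_regular R =
    \<lparr>carrier = carrier R, mult = mult R, one = one R, zero = zero R, add = add R,
     smult = (\<lambda>r x. x \<otimes>\<^bsub>R\<^esub> r)\<rparr>"

text \<open>
  Vectors of length \<open>n\<close> are functions on the index set \<open>{..<n}\<close>, equal to \<open>undefined\<close> outside it.
\<close>

definition power_module :: "('a, 'r) ring_scheme \<Rightarrow> nat \<Rightarrow> ('a, nat \<Rightarrow> 'a) module"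
  where "power_module R n =
    \<lparr>carrier = {..<n} \<rightarrow>\<^sub>E carrier R,
     mult = (\<lambda>x y. \<lambda>i\<in>{..<n}. x i \<otimes>\<^bsub>R\<^esub> y i),
     one = (\<lambda>i\<in>{..<n}. \<one>\<^bsub>R\<^esub>),
     zero = (\<lambda>i\<in>{..<n}. \<zero>\<^bsub>R\<^esub>),
     add = (\<lambda>x y. \<lambda>i\<in>{..<n}. x i \<oplus>\<^bsub>R\<^esub> y i),
     smult = (\<lambda>r x. \<lambda>i\<in>{..<n}. x i \<otimes>\<^bsub>R\<^esub> r)\<rparr>"

definition rmod_free :: "('a, 'r) ring_scheme \<Rightarrow> ('a, 'b, 'm) module_scheme \<Rightarrow> bool"
  where "rmod_free R M \<longleftrightarrow> (\<exists>t. rmod_isomorphic R M (power_module R t))"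


section \<open>Local rings and the Jacobson radical\<close>

definition local_ring :: "('a, 'r) ring_scheme \<Rightarrow> bool"
  where "local_ring R \<longleftrightarrow> ring R \<and> additive_subgroup (carrier R - Units R) R"

definition maximal_right_ideal :: "'a set \<Rightarrow> ('a, 'r) ring_scheme \<Rightarrow> bool"
  where "maximal_right_ideal I R \<longleftrightarrow>
    submodule I R (right_regular R) \<and> I \<noteq> carrier R \<and>
    (\<forall>K. submodule K R (right_regular R) \<longrightarrow> I \<subseteq> K \<longrightarrow> K = I \<or> K = carrier R)"

definition jacobson_radical :: "('a, 'r) ring_scheme \<Rightarrow> 'a set"
  where "jacobson_radical R = carrier R \<inter> \<Inter>{I. maximal_right_ideal I R}"

text \<open>The residue ring \<open>R Quot jacobson_radical R\<close>, regarded as a right module over \<open>R\<close>.\<close>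

definition residue_module :: "('a, 'r) ring_scheme \<Rightarrow> ('a, 'a set) module"
  where "residue_module R =
    (let J = jacobson_radical R; Q = R Quot J in
    \<lparr>carrier = carrier Q, mult = mult Q, one = one Q, zero = zero Q, add = add Q,
     smult = (\<lambda>r X. X \<otimes>\<^bsub>Q\<^esub> (J +>\<^bsub>R\<^esub> r))\<rparr>)"


section \<open>Frobenius rings\<close>

text \<open>
  HOL cannot quantify over the carrier types of all modules. The test modules \<open>M\<close> and \<open>N\<close> below
  have their carriers in the type of the elements of \<open>R\<close>. This includes the right ideals of \<open>R\<close> and \<open>R\<close>
  itself, so by Baer's criterion nothing is lost.
\<close>

definition rmod_injective :: "('a, 'r) ring_scheme \<Rightarrow> ('a, 'b, 'm) module_scheme \<Rightarrow> bool"
  where "rmod_injective R E \<longleftrightarrow> right_module R E \<and>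
    (\<forall>(M :: ('a, 'a) module) (N :: ('a, 'a) module).
       right_module R M \<longrightarrow> right_module R N \<longrightarrow>
       (\<forall>i\<in>rmod_hom R M N. \<forall>f\<in>rmod_hom R M E. inj_on i (carrier M) \<longrightarrow>
          (\<exists>g\<in>rmod_hom R N E. \<forall>x\<in>carrier M. g (i x) = f x)))"

text \<open>Left modules over \<open>R\<close> are right modules over the opposite ring.\<close>

definition opposite_ring :: "('a, 'r) ring_scheme \<Rightarrow> ('a, 'r) ring_scheme"
  where "opposite_ring R = R\<lparr>monoid.mult := (\<lambda>x y. y \<otimes>\<^bsub>R\<^esub> x)\<rparr>"

definition right_self_injective :: "('a, 'r) ring_scheme \<Rightarrow> bool"
  where "right_self_injective R \<longleftrightarrow> rmod_injective R (right_regular R)"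

definition left_self_injective :: "('a, 'r) ring_scheme \<Rightarrow> bool"
  where "left_self_injective R \<longleftrightarrow> right_self_injective (opposite_ring R)"

definition simple_submodule ::
  "'b set \<Rightarrow> ('a, 'r) ring_scheme \<Rightarrow> ('a, 'b, 'm) module_scheme \<Rightarrow> bool"
  where "simple_submodule S R M \<longleftrightarrow> submodule S R M \<and> S \<noteq> {\<zero>\<^bsub>M\<^esub>} \<and>
    (\<forall>T. submodule T R M \<longrightarrow> T \<subseteq> S \<longrightarrow> T = {\<zero>\<^bsub>M\<^esub>} \<or> T = S)"

text \<open>The sum of all simple submodules, as the least submodule containing each of them.\<close>

definition socle :: "('a, 'r) ring_scheme \<Rightarrow> ('a, 'b, 'm) module_scheme \<Rightarrow> 'b set"
  where "socle R M = \<Inter>{H. submodule H R M \<and> (\<forall>S. simple_submodule S R M \<longrightarrow> S \<subseteq> H)}"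

definition finite_frobenius_ring :: "('a, 'r) ring_scheme \<Rightarrow> bool"
  where "finite_frobenius_ring R \<longleftrightarrow>
    ring R \<and> finite (carrier R) \<and> right_self_injective R \<and> left_self_injective R \<and>
    rmod_isomorphic R (residue_module R)
      ((right_regular R)\<lparr>carrier := socle R (right_regular R)\<rparr>)"


section \<open>Codes\<close>

definition linear_code :: "('a, 'r) ring_scheme \<Rightarrow> nat \<Rightarrow> (nat \<Rightarrow> 'a) set \<Rightarrow> bool"
  where "linear_code R n C \<longleftrightarrow> submodule C R (power_module R n)"

definition free_code :: "('a, 'r) ring_scheme \<Rightarrow> nat \<Rightarrow> (nat \<Rightarrow> 'a) set \<Rightarrow> bool"
  where "free_code R n C \<longleftrightarrow>
    linear_code R n C \<and> rmod_free R ((power_module R n)\<lparr>carrier := C\<rparr>)"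

text \<open>
  Over a field, \<open>linear_code\<close> is the notion of a linear subspace, so this definition also covers
  pairs of subspaces.
\<close>

definition LCP ::
  "('a, 'r) ring_scheme \<Rightarrow> nat \<Rightarrow> (nat \<Rightarrow> 'a) set \<Rightarrow> (nat \<Rightarrow> 'a) set \<Rightarrow> bool"
  where "LCP R n C D \<longleftrightarrow> linear_code R n C \<and> linear_code R n D \<and>
    C <+>\<^bsub>power_module R n\<^esub> D = carrier (power_module R n) \<and>
    C \<inter> D = {\<zero>\<^bsub>power_module R n\<^esub>}"

definition residue_map :: "('a, 'r) ring_scheme \<Rightarrow> nat \<Rightarrow> (nat \<Rightarrow> 'a) \<Rightarrow> (nat \<Rightarrow> 'a set)"
  where "residue_map R n x = (\<lambda>i\<in>{..<n}. jacobson_radical R +>\<^bsub>R\<^esub> x i)"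


section \<open>The Jacobson radical of a local ring is its set of non-units\<close>

lemma right_regular_simps [simp]:
  "carrier (right_regular R) = carrier R"
  "zero (right_regular R) = zero R"
  "add (right_regular R) = add R"
  "smult (right_regular R) = (\<lambda>r x. x \<otimes>\<^bsub>R\<^esub> r)"
  by (simp_all add: right_regular_def)

lemma right_ideal_iff:
  "submodule I R (right_regular R) \<longleftrightarrow>
   additive_subgroup I R \<and> (\<forall>r\<in>carrier R. \<forall>x\<in>I. x \<otimes>\<^bsub>R\<^esub> r \<in> I)"
proof -
  have inv: "m_inv (add_monoid (right_regular R)) = m_inv (add_monoid R)"
    by (simp add: m_inv_def fun_eq_iff)
  show ?thesis
    unfolding submodule_def submodule_axioms_def additive_subgroup_def subgroup_def inv
    by (simp add: Ball_def)
qed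

lemma local_ring_right_inverse:
  assumes "local_ring R" and x: "x \<in> carrier R" and y: "y \<in> carrier R"
    and xy: "x \<otimes>\<^bsub>R\<^esub> y = \<one>\<^bsub>R\<^esub>"
  shows "x \<in> Units R"
proof -
  interpret ring R using assms(1) by (simp add: local_ring_def)
  interpret N: additive_subgroup "carrier R - Units R" R
    using assms(1) by (simp add: local_ring_def)
  define e where "e = y \<otimes>\<^bsub>R\<^esub> x"
  have e: "e \<in> carrier R" using x y by (simp add: e_def)
  have "e \<otimes>\<^bsub>R\<^esub> e = y \<otimes>\<^bsub>R\<^esub> ((x \<otimes>\<^bsub>R\<^esub> y) \<otimes>\<^bsub>R\<^esub> x)"
    using x y by (simp add: e_def m_assoc)
  then have ee: "e \<otimes>\<^bsub>R\<^esub> e = e" using x y by (simp add: xy e_def)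
  have zero: "\<zero>\<^bsub>R\<^esub> \<notin> Units R" using N.zero_closed by simp
  have "e \<in> Units R \<or> \<one>\<^bsub>R\<^esub> \<ominus>\<^bsub>R\<^esub> e \<in> Units R"
  proof (rule ccontr)
    assume "\<not> ?thesis"
    then have "e \<in> carrier R - Units R" "\<one>\<^bsub>R\<^esub> \<ominus>\<^bsub>R\<^esub> e \<in> carrier R - Units R"
      using e by auto
    then have "(\<one>\<^bsub>R\<^esub> \<ominus>\<^bsub>R\<^esub> e) \<oplus>\<^bsub>R\<^esub> e \<in> carrier R - Units R"
      by (intro N.a_closed)
    moreover have "(\<one>\<^bsub>R\<^esub> \<ominus>\<^bsub>R\<^esub> e) \<oplus>\<^bsub>R\<^esub> e = \<one>\<^bsub>R\<^esub>"
      using e by (simp add: a_minus_def a_assoc l_neg)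
    ultimately show False by simp
  qed
  moreover have "e = \<one>\<^bsub>R\<^esub>" if "e \<in> Units R"
    using Units_l_cancel[OF that e one_closed] ee e by simp
  moreover have False if u: "\<one>\<^bsub>R\<^esub> \<ominus>\<^bsub>R\<^esub> e \<in> Units R"
  proof -
    have "(\<one>\<^bsub>R\<^esub> \<ominus>\<^bsub>R\<^esub> e) \<otimes>\<^bsub>R\<^esub> e = (\<one>\<^bsub>R\<^esub> \<ominus>\<^bsub>R\<^esub> e) \<otimes>\<^bsub>R\<^esub> \<zero>\<^bsub>R\<^esub>"
      using e by (simp add: a_minus_def l_distr l_minus ee r_neg)
    then have "e = \<zero>\<^bsub>R\<^esub>" using Units_l_cancel[OF u e zero_closed] by simp
    moreover have "\<one>\<^bsub>R\<^esub> = x \<otimes>\<^bsub>R\<^esub> e \<otimes>\<^bsub>R\<^esub> y"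
      using x y xy by (simp add: e_def m_assoc)
    ultimately have "\<one>\<^bsub>R\<^esub> = \<zero>\<^bsub>R\<^esub>" using x y by simp
    then show False using zero Units_one_closed by simp
  qed
  ultimately have "y \<otimes>\<^bsub>R\<^esub> x = \<one>\<^bsub>R\<^esub>" by (auto simp: e_def)
  then show ?thesis using x y xy unfolding Units_def by blast
qed

theorem jacobson_radical_local_ring:
  assumes "local_ring R"
  shows "jacobson_radical R = carrier R - Units R"
proof -
  interpret ring R using assms by (simp add: local_ring_def)
  let ?N = "carrier R - Units R"
  interpret N: additive_subgroup ?N R using assms by (simp add: local_ring_def)
  have N_ideal: "submodule ?N R (right_regular R)"
    unfolding right_ideal_iff
  proof (intro conjI ballI)
    show "additive_subgroup ?N R" by (rule N.is_additive_subgroup)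
  next
    fix r x assume r: "r \<in> carrier R" and x: "x \<in> ?N"
    have "x \<otimes>\<^bsub>R\<^esub> r \<notin> Units R"
    proof
      assume u: "x \<otimes>\<^bsub>R\<^esub> r \<in> Units R"
      then have "x \<otimes>\<^bsub>R\<^esub> (r \<otimes>\<^bsub>R\<^esub> inv\<^bsub>R\<^esub> (x \<otimes>\<^bsub>R\<^esub> r)) = \<one>\<^bsub>R\<^esub>"
        using r x Units_r_inv[OF u] by (simp add: m_assoc[symmetric])
      moreover have "r \<otimes>\<^bsub>R\<^esub> inv\<^bsub>R\<^esub> (x \<otimes>\<^bsub>R\<^esub> r) \<in> carrier R" using u r by simp
      moreover have "x \<in> carrier R" using x by simp
      ultimately have "x \<in> Units R"
        using local_ring_right_inverse[OF assms] by metis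
      then show False using x by simp
    qed
    then show "x \<otimes>\<^bsub>R\<^esub> r \<in> ?N" using r x by simp
  qed
  have proper: "K \<subseteq> ?N"
    if K: "submodule K R (right_regular R)" and ne: "K \<noteq> carrier R" for K
  proof
    fix x assume x: "x \<in> K"
    have KR: "K \<subseteq> carrier R"
      using K by (auto simp: right_ideal_iff dest: additive_subgroup.a_subset)
    have "x \<notin> Units R"
    proof
      assume u: "x \<in> Units R"
      have "carrier R \<subseteq> K"
      proof
        fix r assume r: "r \<in> carrier R"
        have "x \<otimes>\<^bsub>R\<^esub> (inv\<^bsub>R\<^esub> x \<otimes>\<^bsub>R\<^esub> r) \<in> K"
          using K x u r by (simp add: right_ideal_iff)
        moreover have "x \<otimes>\<^bsub>R\<^esub> (inv\<^bsub>R\<^esub> x \<otimes>\<^bsub>R\<^esub> r) = r"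
          using u r Units_closed[OF u] Units_r_inv[OF u] by (simp add: m_assoc[symmetric])
        ultimately show "r \<in> K" by simp
      qed
      then show False using KR ne by auto
    qed
    then show "x \<in> ?N" using x KR by auto
  qed
  have ne: "?N \<noteq> carrier R" using Units_one_closed by auto
  have "maximal_right_ideal ?N R"
    unfolding maximal_right_ideal_def using N_ideal ne proper by blast
  moreover have "I = ?N" if "maximal_right_ideal I R" for I
    using that proper N_ideal ne unfolding maximal_right_ideal_def by blast
  ultimately have "{I. maximal_right_ideal I R} = {?N}" by blast
  then show ?thesis by (auto simp: jacobson_radical_def)
qed

end

theory Submission
  imports Defs
begin

text \<open>
  If \<open>R\<^sup>n = C \<oplus> D\<close>, the projection to \<open>C\<close> maps \<open>J\<^sup>n\<close> into \<open>J\<^sup>n\<close>, so \<open>c - d \<in> J\<^sup>n\<close> with \<open>c \<in> C\<close>,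
  \<open>d \<in> D\<close> forces \<open>c \<in> J\<^sup>n\<close>. Conversely, \<open>\<pi>(C) + \<pi>(D) = F\<^sub>q\<^sup>n\<close> means \<open>C + D + R\<^sup>n J = R\<^sup>n\<close>, and
  Nakayama's lemma gives \<open>C + D = R\<^sup>n\<close>. As \<open>R\<^sup>n\<close> is projective, there are homomorphisms \<open>p\<close> into \<open>C\<close>
  and \<open>q\<close> into \<open>D\<close> with \<open>p + q = id\<close>. Now \<open>N = C \<inter> D\<close> lies in \<open>J\<^sup>n\<close>, and freeness of \<open>C\<close> gives
  \<open>C \<inter> J\<^sup>n = C J\<close>: some \<open>z \<noteq> 0\<close> has \<open>J z = 0\<close>, and it kills no unit coordinate. As \<open>q\<close> maps \<open>C\<close> to \<open>N\<close> and
  \<open>p\<close> maps \<open>D\<close> to \<open>N\<close>, it follows that \<open>N = N J\<close>, and Nakayama's lemma again gives \<open>N = 0\<close>.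
\<close>

section \<open>Right modules\<close>

lemma (in abelian_group) add_minus_cancel:
  assumes "x \<in> carrier G" and "y \<in> carrier G"
  shows "(x \<oplus> y) \<ominus> x = y"
proof -
  have "(x \<oplus> y) \<ominus> x = y \<oplus> (x \<oplus> \<ominus> x)"
    unfolding a_minus_def a_comm[OF assms] using assms by (intro a_assoc) auto
  then show ?thesis using assms by (simp add: r_neg)
qed

text \<open>Shaped for the induction step of \<open>power_module_projection_exists\<close>: there
  the truncated vector grows by \<open>u + v\<close>, its projection only by the
  \<open>C\<close>-part \<open>u\<close>, and the difference therefore by the \<open>D\<close>-part
  \<open>v\<close>.\<close>

lemma (in abelian_group) add_minus_add_cancel:
  assumes "x \<in> carrier G" and "y \<in> carrier G" and "u \<in> carrier G" and "v \<in> carrier G"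
  shows "(x \<oplus> (u \<oplus> v)) \<ominus> (y \<oplus> u) = (x \<ominus> y) \<oplus> v"
proof -
  have "(x \<oplus> (u \<oplus> v)) \<ominus> (y \<oplus> u) = ((x \<ominus> y) \<oplus> v) \<oplus> (u \<oplus> \<ominus> u)"
    unfolding a_minus_def using assms by (simp only: minus_add a_inv_closed a_closed a_ac)
  then show ?thesis using assms by (simp add: r_neg)
qed

lemma (in abelian_group) minus_eq_zero_iff:
  assumes "x \<in> carrier G" and "y \<in> carrier G"
  shows "x \<ominus> y = \<zero> \<longleftrightarrow> x = y"
proof
  assume "x \<ominus> y = \<zero>"
  then show "x = y"
    using minus_equality[of x "\<ominus> y"] assms by (simp add: a_minus_def)
qed (use assms in \<open>simp add: a_minus_def r_neg\<close>)

lemma (in abelian_group) additive_subgroupI: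
  assumes "H \<subseteq> carrier G" and "\<zero> \<in> H"
    and "\<And>x. x \<in> H \<Longrightarrow> \<ominus> x \<in> H"
    and "\<And>x y. \<lbrakk>x \<in> H; y \<in> H\<rbrakk> \<Longrightarrow> x \<oplus> y \<in> H"
  shows "additive_subgroup H G"
  unfolding additive_subgroup_def
  by (rule add.subgroupI) (use assms in \<open>auto simp: a_inv_def\<close>)

section \<open>Scalar arithmetic and submodules\<close>

context right_module
begin

lemma submodule_imp_additive_subgroup:
  "submodule K R M \<Longrightarrow> additive_subgroup K M"
  by (simp add: additive_subgroup.intro submodule.axioms(1))

lemma smult_r_null:
  assumes r: "r \<in> carrier R"
  shows "r \<odot>\<^bsub>M\<^esub> \<zero>\<^bsub>M\<^esub> = \<zero>\<^bsub>M\<^esub>"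
proof -
  have "r \<odot>\<^bsub>M\<^esub> \<zero>\<^bsub>M\<^esub> \<oplus>\<^bsub>M\<^esub> r \<odot>\<^bsub>M\<^esub> \<zero>\<^bsub>M\<^esub> = r \<odot>\<^bsub>M\<^esub> \<zero>\<^bsub>M\<^esub>"
    using smult_vector_distr[OF r M.zero_closed M.zero_closed] by simp
  then show ?thesis using smult_closed[OF r M.zero_closed] by simp
qed

lemma smult_r_minus:
  assumes "r \<in> carrier R" and "x \<in> carrier M"
  shows "r \<odot>\<^bsub>M\<^esub> (\<ominus>\<^bsub>M\<^esub> x) = \<ominus>\<^bsub>M\<^esub> (r \<odot>\<^bsub>M\<^esub> x)"
proof -
  have "r \<odot>\<^bsub>M\<^esub> (\<ominus>\<^bsub>M\<^esub> x) \<oplus>\<^bsub>M\<^esub> r \<odot>\<^bsub>M\<^esub> x = \<zero>\<^bsub>M\<^esub>"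
    using assms by (simp add: smult_vector_distr[symmetric] M.l_neg smult_r_null)
  then show ?thesis
    using assms by (simp add: M.minus_equality smult_closed)
qed

lemma smult_l_null:
  assumes x: "x \<in> carrier M"
  shows "\<zero>\<^bsub>R\<^esub> \<odot>\<^bsub>M\<^esub> x = \<zero>\<^bsub>M\<^esub>"
proof -
  have "\<zero>\<^bsub>R\<^esub> \<odot>\<^bsub>M\<^esub> x \<oplus>\<^bsub>M\<^esub> \<zero>\<^bsub>R\<^esub> \<odot>\<^bsub>M\<^esub> x = \<zero>\<^bsub>R\<^esub> \<odot>\<^bsub>M\<^esub> x"
    using smult_scalar_distr[OF R.zero_closed R.zero_closed x] by simp
  then show ?thesis using smult_closed[OF R.zero_closed x] by simp
qed

lemma smult_l_minus:
  assumes "r \<in> carrier R" and "x \<in> carrier M"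
  shows "(\<ominus>\<^bsub>R\<^esub> r) \<odot>\<^bsub>M\<^esub> x = \<ominus>\<^bsub>M\<^esub> (r \<odot>\<^bsub>M\<^esub> x)"
proof -
  have "(\<ominus>\<^bsub>R\<^esub> r) \<odot>\<^bsub>M\<^esub> x \<oplus>\<^bsub>M\<^esub> r \<odot>\<^bsub>M\<^esub> x = \<zero>\<^bsub>M\<^esub>"
    using assms by (simp add: smult_scalar_distr[symmetric] R.l_neg smult_l_null)
  then show ?thesis
    using assms by (simp add: M.minus_equality smult_closed)
qed

lemma submoduleI:
  assumes "H \<subseteq> carrier M" and "\<zero>\<^bsub>M\<^esub> \<in> H"
    and "\<And>x y. \<lbrakk>x \<in> H; y \<in> H\<rbrakk> \<Longrightarrow> x \<oplus>\<^bsub>M\<^esub> y \<in> H"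
    and smult: "\<And>r x. \<lbrakk>r \<in> carrier R; x \<in> H\<rbrakk> \<Longrightarrow> r \<odot>\<^bsub>M\<^esub> x \<in> H"
  shows "submodule H R M"
proof -
  \<comment> \<open>Negation is scaling by minus one.\<close>
  have "\<ominus>\<^bsub>M\<^esub> x \<in> H" if "x \<in> H" for x
  proof -
    have "x \<in> carrier M" using that assms(1) by blast
    then show ?thesis
      using smult[OF _ that, of "\<ominus>\<^bsub>R\<^esub> \<one>\<^bsub>R\<^esub>"] by (simp add: smult_l_minus smult_one)
  qed
  then have "additive_subgroup H M" using assms by (intro M.additive_subgroupI)
  then show ?thesis
    using smult by (simp add: submodule_def submodule_axioms_def additive_subgroup_def)
qed

lemma submoduleD:
  assumes "submodule K R M"
  shows "K \<subseteq> carrier M" and "\<zero>\<^bsub>M\<^esub> \<in> K"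
    and "\<And>x y. \<lbrakk>x \<in> K; y \<in> K\<rbrakk> \<Longrightarrow> x \<oplus>\<^bsub>M\<^esub> y \<in> K"
    and "\<And>x y. \<lbrakk>x \<in> K; y \<in> K\<rbrakk> \<Longrightarrow> x \<ominus>\<^bsub>M\<^esub> y \<in> K"
    and "\<And>r x. \<lbrakk>r \<in> carrier R; x \<in> K\<rbrakk> \<Longrightarrow> r \<odot>\<^bsub>M\<^esub> x \<in> K"
proof -
  interpret K: additive_subgroup K M by (rule submodule_imp_additive_subgroup[OF assms])
  show "K \<subseteq> carrier M" "\<zero>\<^bsub>M\<^esub> \<in> K" by (rule K.a_subset, rule K.zero_closed)
  show "x \<oplus>\<^bsub>M\<^esub> y \<in> K" if "x \<in> K" "y \<in> K" for x y using that by simp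
  show "x \<ominus>\<^bsub>M\<^esub> y \<in> K" if "x \<in> K" "y \<in> K" for x y
    using that M.add.subgroupE(3)[OF K.a_subgroup] by (simp add: a_minus_def a_inv_def)
  show "r \<odot>\<^bsub>M\<^esub> x \<in> K" if "r \<in> carrier R" "x \<in> K" for r x
    using submodule.smult_closed[OF assms that] .
qed

end

section \<open>Homomorphisms of right modules\<close>

lemma rmod_homD:
  assumes "h \<in> rmod_hom R M N"
  shows "x \<in> carrier M \<Longrightarrow> h x \<in> carrier N"
    and "\<lbrakk>x \<in> carrier M; y \<in> carrier M\<rbrakk> \<Longrightarrow> h (x \<oplus>\<^bsub>M\<^esub> y) = h x \<oplus>\<^bsub>N\<^esub> h y"
    and "\<lbrakk>r \<in> carrier R; x \<in> carrier M\<rbrakk> \<Longrightarrow> h (r \<odot>\<^bsub>M\<^esub> x) = r \<odot>\<^bsub>N\<^esub> h x"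
  using assms by (auto simp: rmod_hom_def)

lemma rmod_hom_zero:
  assumes "right_module R M" and "right_module R N" and "h \<in> rmod_hom R M N"
  shows "h \<zero>\<^bsub>M\<^esub> = \<zero>\<^bsub>N\<^esub>"
proof -
  interpret M: right_module R M by fact
  interpret N: right_module R N by fact
  have "h \<zero>\<^bsub>M\<^esub> \<oplus>\<^bsub>N\<^esub> h \<zero>\<^bsub>M\<^esub> = h \<zero>\<^bsub>M\<^esub>"
    using rmod_homD(2)[OF assms(3), of "\<zero>\<^bsub>M\<^esub>" "\<zero>\<^bsub>M\<^esub>"] by simp
  then show ?thesis
    using rmod_homD(1)[OF assms(3), of "\<zero>\<^bsub>M\<^esub>"] by simp
qed


section \<open>Powers of the regular module\<close>

lemma power_module_simps [simp]:
  "carrier (power_module R n) = {..<n} \<rightarrow>\<^sub>E carrier R"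
  "zero (power_module R n) = (\<lambda>i\<in>{..<n}. \<zero>\<^bsub>R\<^esub>)"
  "add (power_module R n) = (\<lambda>x y. \<lambda>i\<in>{..<n}. x i \<oplus>\<^bsub>R\<^esub> y i)"
  "smult (power_module R n) = (\<lambda>r x. \<lambda>i\<in>{..<n}. x i \<otimes>\<^bsub>R\<^esub> r)"
  by (simp_all add: power_module_def)

lemma power_module_eqI:
  assumes "x \<in> {..<n} \<rightarrow>\<^sub>E A" and "y \<in> {..<n} \<rightarrow>\<^sub>E B" and "\<And>i. i < n \<Longrightarrow> x i = y i"
  shows "x = y"
  using assms by (intro PiE_ext[of x "{..<n}" "\<lambda>_. A \<union> B"]) auto

context ring
begin

lemma right_module_power_module: "right_module R (power_module R n)"
proof -
  let ?P = "power_module R n"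
  have mem: "x i \<in> carrier R" if "x \<in> carrier ?P" "i < n" for x i
    using that PiE_mem[of x "{..<n}" "\<lambda>_. carrier R" i] by simp
  have add: "x \<oplus>\<^bsub>?P\<^esub> y \<in> carrier ?P" if "x \<in> carrier ?P" "y \<in> carrier ?P" for x y
    using mem[OF that(1)] mem[OF that(2)] by simp
  have smult: "r \<odot>\<^bsub>?P\<^esub> x \<in> carrier ?P" if "r \<in> carrier R" "x \<in> carrier ?P" for r x
    using mem[OF that(2)] that(1) by simp
  have zero: "\<zero>\<^bsub>?P\<^esub> \<in> carrier ?P" by simp
  have eqI: "x = y" if "x \<in> carrier ?P" "y \<in> carrier ?P" "\<And>i. i < n \<Longrightarrow> x i = y i" for x y
    using that by (intro power_module_eqI[of x n "carrier R" y "carrier R"]) simp_all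
  have "abelian_group ?P"
  proof (rule abelian_groupI)
    fix x y z assume xyz: "x \<in> carrier ?P" "y \<in> carrier ?P" "z \<in> carrier ?P"
    show "x \<oplus>\<^bsub>?P\<^esub> y \<oplus>\<^bsub>?P\<^esub> z = x \<oplus>\<^bsub>?P\<^esub> (y \<oplus>\<^bsub>?P\<^esub> z)"
      by (rule eqI; (intro add xyz)?) (simp add: mem[OF xyz(1)] mem[OF xyz(2)] mem[OF xyz(3)] a_assoc)
  next
    fix x y assume xy: "x \<in> carrier ?P" "y \<in> carrier ?P"
    show "x \<oplus>\<^bsub>?P\<^esub> y = y \<oplus>\<^bsub>?P\<^esub> x"
      by (rule eqI; (intro add xy)?) (simp add: mem[OF xy(1)] mem[OF xy(2)] a_comm)
  next
    fix x assume x: "x \<in> carrier ?P"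
    show "\<zero>\<^bsub>?P\<^esub> \<oplus>\<^bsub>?P\<^esub> x = x"
      by (rule eqI; (intro add zero x)?) (simp add: mem[OF x])
    have "(\<lambda>i\<in>{..<n}. \<ominus> x i) \<in> carrier ?P" using mem[OF x] by simp
    moreover from this have "(\<lambda>i\<in>{..<n}. \<ominus> x i) \<oplus>\<^bsub>?P\<^esub> x = \<zero>\<^bsub>?P\<^esub>"
      by (intro eqI add zero x) (simp_all add: mem[OF x] l_neg)
    ultimately show "\<exists>y\<in>carrier ?P. y \<oplus>\<^bsub>?P\<^esub> x = \<zero>\<^bsub>?P\<^esub>" by blast
  qed (intro add zero; assumption)+
  moreover have "right_module_axioms R ?P"
  proof
    \<comment> \<open>Scalars multiply the entries from the right, so distributivity over a sum of
      scalars is \<open>r_distr\<close>, and in the product \<open>r\<close> acts before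
      \<open>s\<close>.\<close>
    fix r s x assume r: "r \<in> carrier R" and s: "s \<in> carrier R" and x: "x \<in> carrier ?P"
    show "(r \<oplus> s) \<odot>\<^bsub>?P\<^esub> x = r \<odot>\<^bsub>?P\<^esub> x \<oplus>\<^bsub>?P\<^esub> s \<odot>\<^bsub>?P\<^esub> x"
      by (rule eqI; (intro add smult r s x a_closed)?) (simp add: mem[OF x] r s r_distr)
    show "(r \<otimes> s) \<odot>\<^bsub>?P\<^esub> x = s \<odot>\<^bsub>?P\<^esub> (r \<odot>\<^bsub>?P\<^esub> x)"
      by (rule eqI; (intro smult r s x m_closed)?) (simp add: mem[OF x] r s m_assoc)
  next
    fix r x y assume r: "r \<in> carrier R" and x: "x \<in> carrier ?P" and y: "y \<in> carrier ?P"
    show "r \<odot>\<^bsub>?P\<^esub> (x \<oplus>\<^bsub>?P\<^esub> y) = r \<odot>\<^bsub>?P\<^esub> x \<oplus>\<^bsub>?P\<^esub> r \<odot>\<^bsub>?P\<^esub> y"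
      by (rule eqI; (intro add smult r x y)?) (simp add: mem[OF x] mem[OF y] r l_distr)
  next
    fix x assume x: "x \<in> carrier ?P"
    show "\<one> \<odot>\<^bsub>?P\<^esub> x = x"
      by (rule eqI; (intro smult x one_closed)?) (simp add: mem[OF x])
  qed (rule smult; assumption)
  ultimately show ?thesis
    by (intro right_module.intro ring_axioms)
qed

lemma power_module_minus_apply:
  assumes x: "x \<in> carrier (power_module R n)" and y: "y \<in> carrier (power_module R n)" and i: "i < n"
  shows "(x \<ominus>\<^bsub>power_module R n\<^esub> y) i = x i \<ominus> y i"
proof -
  interpret P: right_module R "power_module R n" by (rule right_module_power_module)
  let ?z = "x \<ominus>\<^bsub>power_module R n\<^esub> y"
  have z: "?z \<in> carrier (power_module R n)" using x y by (rule P.M.minus_closed)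
  have mem: "u i \<in> carrier R" if "u \<in> carrier (power_module R n)" for u
    using that i PiE_mem[of u "{..<n}" "\<lambda>_. carrier R" i] by simp
  \<comment> \<open>The negative in the power module is only characterised as an additive inverse,
    so the coordinate of the difference is read off from this equation.\<close>
  have "?z \<oplus>\<^bsub>power_module R n\<^esub> y = x"
    using x y by (simp add: a_minus_def P.M.a_assoc P.M.l_neg del: power_module_simps)
  then have "(?z \<oplus>\<^bsub>power_module R n\<^esub> y) i = x i" by (rule arg_cong)
  then have "x i = ?z i \<oplus> y i" using i by simp
  then show ?thesis
    using mem[OF y] mem[OF z] by (metis a_minus_def a_assoc a_inv_closed r_neg r_zero)
qed

text \<open>The image of a vector with entries in \<open>J\<close> lies in \<open>N J\<close>, represented by an
  arbitrary additive subgroup \<open>L\<close> that contains all the products \<open>x \<cdot> j\<close>.\<close>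

lemma rmod_hom_power_module_image:
  assumes M: "right_module R M" and f: "f \<in> rmod_hom R (power_module R s) M"
    and fN: "\<And>x. x \<in> {..<s} \<rightarrow>\<^sub>E carrier R \<Longrightarrow> f x \<in> N"
    and J: "J \<subseteq> carrier R" and L: "additive_subgroup L M"
    and NJ: "\<And>x j. \<lbrakk>x \<in> N; j \<in> J\<rbrakk> \<Longrightarrow> j \<odot>\<^bsub>M\<^esub> x \<in> L"
    and a: "a \<in> {..<s} \<rightarrow>\<^sub>E J"
  shows "f a \<in> L"
proof -
  interpret P: right_module R "power_module R s" by (rule right_module_power_module)
  interpret M: right_module R M by fact
  interpret L: additive_subgroup L M by fact
  \<comment> \<open>The vector \<open>a\<close> is built up one coordinate at a time:
    \<open>trunc (Suc k)\<close> is \<open>trunc k\<close> plus the basis vector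
    \<open>unit k\<close> scaled by \<open>a k\<close>. Since \<open>f (unit k)\<close> lies in
    \<open>N\<close> and \<open>a k\<close> in \<open>J\<close>, each new summand of the image lies
    in \<open>L\<close>.\<close>
  define trunc where "trunc k = (\<lambda>i\<in>{..<s}. if i < k then a i else \<zero>)" for k
  define unit where "unit k = (\<lambda>i\<in>{..<s}. if i = k then \<one> else \<zero>)" for k :: nat
  have aR: "a i \<in> carrier R" "a i \<in> J" if "i < s" for i
    using PiE_mem[of a "{..<s}" "\<lambda>_. J" i] a J that by auto
  have trunc: "trunc k \<in> carrier (power_module R s)" for k
    using aR by (auto simp: trunc_def)
  have unit: "unit k \<in> carrier (power_module R s)" for k
    by (auto simp: unit_def)
  have "k \<le> s \<Longrightarrow> f (trunc k) \<in> L" for k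
  proof (induction k)
    case 0
    have "trunc 0 = \<zero>\<^bsub>power_module R s\<^esub>" by (auto simp: trunc_def)
    then show ?case
      using rmod_hom_zero[OF P.right_module_axioms M f] L.zero_closed by (simp del: power_module_simps)
  next
    case (Suc k)
    have "trunc (Suc k) = trunc k \<oplus>\<^bsub>power_module R s\<^esub> (a k \<odot>\<^bsub>power_module R s\<^esub> unit k)"
      using Suc.prems aR by (auto simp: trunc_def unit_def fun_eq_iff less_Suc_eq)
    then have "f (trunc (Suc k)) = f (trunc k) \<oplus>\<^bsub>M\<^esub> a k \<odot>\<^bsub>M\<^esub> f (unit k)"
      using Suc.prems aR trunc unit by (simp add: rmod_homD[OF f] P.smult_closed del: power_module_simps)
    moreover have "a k \<odot>\<^bsub>M\<^esub> f (unit k) \<in> L"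
      using NJ fN unit aR Suc.prems by auto
    ultimately show ?case using Suc by simp
  qed
  \<comment> \<open>Both sides are \<open>undefined\<close> outside the index set, so the equality
    holds for functions and not just on coordinates.\<close>
  moreover have "trunc s = a"
    using PiE_arb[OF a] by (auto simp: trunc_def fun_eq_iff)
  ultimately show ?thesis by (metis order_refl)
qed

text \<open>The free module \<open>R\<^sup>n\<close> is projective: choose \<open>p\<close> on the standard basis and extend linearly.\<close>

lemma power_module_projection_exists:
  assumes C: "linear_code R n C" and D: "linear_code R n D"
    and sum: "C <+>\<^bsub>power_module R n\<^esub> D = carrier (power_module R n)"
  obtains p where "p \<in> rmod_hom R (power_module R n) (power_module R n)"
    and "\<And>x. x \<in> {..<n} \<rightarrow>\<^sub>E carrier R \<Longrightarrow> p x \<in> C"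
    and "\<And>x. x \<in> {..<n} \<rightarrow>\<^sub>E carrier R \<Longrightarrow> x \<ominus>\<^bsub>power_module R n\<^esub> p x \<in> D"
proof -
  let ?P = "power_module R n"
  interpret P: right_module R ?P by (rule right_module_power_module)
  have C': "submodule C R ?P" and D': "submodule D R ?P"
    using C D by (simp_all add: linear_code_def)
  define trunc where "trunc k x = (\<lambda>i\<in>{..<n}. if i < k then x i else \<zero>)" for k :: nat and x
  have trunc: "trunc k x \<in> carrier ?P" if "x \<in> carrier ?P" for k x
    using PiE_mem[of x "{..<n}" "\<lambda>_. carrier R"] that by (simp add: trunc_def)
  have full: "trunc n x = x" if "x \<in> carrier ?P" for x
    using PiE_arb[of x "{..<n}" "\<lambda>_. carrier R"] that by (auto simp: trunc_def fun_eq_iff)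
  \<comment> \<open>Induction over the basis vectors: at stage \<open>k\<close> the map
    \<open>p\<close> splits correctly the part of \<open>x\<close> supported on the first
    \<open>k\<close> coordinates.\<close>
  have "k \<le> n \<Longrightarrow> \<exists>p\<in>rmod_hom R ?P ?P. \<forall>x\<in>carrier ?P. p x \<in> C \<and> trunc k x \<ominus>\<^bsub>?P\<^esub> p x \<in> D" for k
  proof (induction k)
    case 0
    have "trunc 0 x \<ominus>\<^bsub>?P\<^esub> \<zero>\<^bsub>?P\<^esub> = \<zero>\<^bsub>?P\<^esub>" for x
      using P.M.r_neg[OF P.M.zero_closed] by (simp add: trunc_def a_minus_def)
    moreover have "(\<lambda>x. \<zero>\<^bsub>?P\<^esub>) \<in> rmod_hom R ?P ?P"
      by (simp add: rmod_hom_def P.smult_r_null del: power_module_simps)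
    ultimately show ?case
      using P.submoduleD(2)[OF C'] P.submoduleD(2)[OF D']
      by (intro bexI[of _ "\<lambda>x. \<zero>\<^bsub>?P\<^esub>"] ballI conjI) (simp_all del: power_module_simps)
  next
    case (Suc k)
    then obtain p where p: "p \<in> rmod_hom R ?P ?P"
      and pC: "\<And>x. x \<in> carrier ?P \<Longrightarrow> p x \<in> C"
      and pD: "\<And>x. x \<in> carrier ?P \<Longrightarrow> trunc k x \<ominus>\<^bsub>?P\<^esub> p x \<in> D"
      by auto
    \<comment> \<open>The next basis vector splits as \<open>c + d\<close> because \<open>C\<close>
      and \<open>D\<close> span; the extended map sends it to \<open>c\<close>.\<close>
    define unit where "unit = (\<lambda>i\<in>{..<n}. if i = k then \<one> else \<zero>)"
    have "unit \<in> carrier ?P" by (auto simp: unit_def)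
    then obtain c d where c: "c \<in> C" and d: "d \<in> D" and cd: "unit = c \<oplus>\<^bsub>?P\<^esub> d"
      unfolding sum[symmetric] set_add_def' by blast
    have cP: "c \<in> carrier ?P" and dP: "d \<in> carrier ?P"
      using c d P.submoduleD(1)[OF C'] P.submoduleD(1)[OF D'] by auto
    have xk: "x k \<in> carrier R" if "x \<in> carrier ?P" for x
      using that Suc.prems PiE_mem[of x "{..<n}" "\<lambda>_. carrier R" k] by simp
    \<comment> \<open>The added term is right linear in \<open>x\<close>: scaling \<open>x\<close>
      by \<open>r\<close> turns its entry \<open>x k\<close> into \<open>x k\<close> times
      \<open>r\<close>, and acting on \<open>c\<close> by this product is acting by
      \<open>x k\<close> and then by \<open>r\<close>.\<close>
    define p' where "p' x = p x \<oplus>\<^bsub>?P\<^esub> x k \<odot>\<^bsub>?P\<^esub> c" for x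
    have "p' \<in> rmod_hom R ?P ?P"
      unfolding rmod_hom_def
    proof (intro CollectI conjI ballI Pi_I)
      fix x assume x: "x \<in> carrier ?P"
      then show "p' x \<in> carrier ?P"
        using xk[OF x] cP rmod_homD(1)[OF p x] unfolding p'_def
        by (intro P.M.a_closed P.smult_closed)
      fix y assume y: "y \<in> carrier ?P"
      have "(x \<oplus>\<^bsub>?P\<^esub> y) k = x k \<oplus> y k" using Suc.prems by simp
      then show "p' (x \<oplus>\<^bsub>?P\<^esub> y) = p' x \<oplus>\<^bsub>?P\<^esub> p' y"
        using x y xk cP rmod_homD[OF p]
        by (simp add: p'_def P.smult_scalar_distr P.smult_closed P.M.a_ac del: power_module_simps)
    next
      fix r x assume r: "r \<in> carrier R" and x: "x \<in> carrier ?P"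
      have "(r \<odot>\<^bsub>?P\<^esub> x) k = x k \<otimes> r" using Suc.prems by simp
      then show "p' (r \<odot>\<^bsub>?P\<^esub> x) = r \<odot>\<^bsub>?P\<^esub> p' x"
        using r x xk cP rmod_homD[OF p]
        by (simp add: p'_def P.smult_vector_distr P.smult_assoc P.smult_closed del: power_module_simps)
    qed
    moreover have "p' x \<in> C" if "x \<in> carrier ?P" for x
      unfolding p'_def using that c pC xk by (intro P.submoduleD[OF C'])
    moreover have "trunc (Suc k) x \<ominus>\<^bsub>?P\<^esub> p' x \<in> D" if x: "x \<in> carrier ?P" for x
    proof -
      have "trunc (Suc k) x = trunc k x \<oplus>\<^bsub>?P\<^esub> x k \<odot>\<^bsub>?P\<^esub> unit"
        using Suc.prems x PiE_mem[of x "{..<n}" "\<lambda>_. carrier R"]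
        by (simp add: trunc_def unit_def fun_eq_iff less_Suc_eq)
      also have "x k \<odot>\<^bsub>?P\<^esub> unit = x k \<odot>\<^bsub>?P\<^esub> c \<oplus>\<^bsub>?P\<^esub> x k \<odot>\<^bsub>?P\<^esub> d"
        using cP dP xk[OF x] unfolding cd by (rule P.smult_vector_distr[rotated])
      finally have "trunc (Suc k) x \<ominus>\<^bsub>?P\<^esub> p' x =
          (trunc k x \<ominus>\<^bsub>?P\<^esub> p x) \<oplus>\<^bsub>?P\<^esub> x k \<odot>\<^bsub>?P\<^esub> d"
        using x xk[OF x] cP dP trunc[OF x] rmod_homD(1)[OF p x]
        by (simp add: p'_def P.smult_closed P.M.add_minus_add_cancel del: power_module_simps)
      then show ?thesis
        using pD[OF x] xk[OF x] d P.submoduleD[OF D'] by (simp del: power_module_simps)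
    qed
    ultimately show ?case by blast
  qed
  from this[OF order_refl] have "\<exists>p\<in>rmod_hom R ?P ?P. \<forall>x\<in>carrier ?P. p x \<in> C \<and> x \<ominus>\<^bsub>?P\<^esub> p x \<in> D"
    using full by (metis (no_types, lifting))
  then show ?thesis
    unfolding power_module_simps(1) using that by blast
qed

text \<open>Freeness supplies an isomorphism from \<open>C\<close> to a power of \<open>R\<close>.
  Its inverse, viewed as a map into the ambient space, presents codewords by coordinate vectors, to
  which \<open>injective_rmod_hom_reflects_radical\<close> applies.\<close>

lemma free_code_parametrization:
  assumes "free_code R n C"
  obtains t h where "h \<in> rmod_hom R (power_module R t) (power_module R n)"
    and "bij_betw h ({..<t} \<rightarrow>\<^sub>E carrier R) C"
proof -
  let ?C = "(power_module R n)\<lparr>carrier := C\<rparr>"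
  obtain t g where g: "g \<in> rmod_hom R ?C (power_module R t)"
    and bij: "bij_betw g C ({..<t} \<rightarrow>\<^sub>E carrier R)"
    using assms by (auto simp: free_code_def rmod_free_def rmod_isomorphic_def)
  interpret P: right_module R "power_module R n" by (rule right_module_power_module)
  have C: "submodule C R (power_module R n)"
    using assms by (simp add: free_code_def linear_code_def)
  define h where "h = inv_into C g"
  have h: "h a \<in> C" "g (h a) = a" if "a \<in> carrier (power_module R t)" for a
    using that bij by (auto simp: h_def bij_betw_def inv_into_into f_inv_into_f)
  have hg: "h (g x) = x" if "x \<in> C" for x
    using that bij by (simp add: h_def bij_betw_def)
  have "h \<in> rmod_hom R (power_module R t) (power_module R n)"
    unfolding rmod_hom_def
  proof (intro CollectI conjI ballI Pi_I)
    fix a assume a: "a \<in> carrier (power_module R t)"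
    show "h a \<in> carrier (power_module R n)" using h(1)[OF a] P.submoduleD(1)[OF C] by blast
    fix b assume b: "b \<in> carrier (power_module R t)"
    \<comment> \<open>Linearity of the inverse: \<open>g\<close> is computed on the sum of
      codewords, and applying \<open>h\<close> recovers that sum because \<open>C\<close> is closed
      under addition.\<close>
    have "g (h a \<oplus>\<^bsub>power_module R n\<^esub> h b) = a \<oplus>\<^bsub>power_module R t\<^esub> b"
      using rmod_homD(2)[OF g, of "h a" "h b"] h[OF a] h[OF b] by (simp del: power_module_simps)
    then show "h (a \<oplus>\<^bsub>power_module R t\<^esub> b) = h a \<oplus>\<^bsub>power_module R n\<^esub> h b"
      using hg[OF P.submoduleD(3)[OF C h(1)[OF a] h(1)[OF b]]] by (simp del: power_module_simps)
  next
    fix r a assume r: "r \<in> carrier R" and a: "a \<in> carrier (power_module R t)"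
    have "g (r \<odot>\<^bsub>power_module R n\<^esub> h a) = r \<odot>\<^bsub>power_module R t\<^esub> a"
      using rmod_homD(3)[OF g r, of "h a"] h[OF a] by (simp del: power_module_simps)
    then show "h (r \<odot>\<^bsub>power_module R t\<^esub> a) = r \<odot>\<^bsub>power_module R n\<^esub> h a"
      using hg[OF P.submoduleD(5)[OF C r h(1)[OF a]]] by (simp del: power_module_simps)
  qed
  then show ?thesis
    using that bij_betw_inv_into[OF bij] by (simp add: h_def)
qed

end


section \<open>Nakayama's lemma over a finite local ring\<close>

text \<open>If \<open>x y\<close> is a unit, then \<open>x\<close> has a right inverse, which in a
  local ring makes it a unit. Then \<open>y\<close> is the inverse of \<open>x\<close> times
  \<open>x y\<close>, a product of units.\<close>

lemma local_ring_Units_factors: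
  assumes loc: "local_ring R" and x: "x \<in> carrier R" and y: "y \<in> carrier R"
    and xy: "x \<otimes>\<^bsub>R\<^esub> y \<in> Units R"
  shows "x \<in> Units R" and "y \<in> Units R"
proof -
  interpret ring R using loc by (simp add: local_ring_def)
  have inv: "inv\<^bsub>R\<^esub> (x \<otimes>\<^bsub>R\<^esub> y) \<in> carrier R" using xy by (rule Units_inv_closed)
  have "x \<otimes>\<^bsub>R\<^esub> (y \<otimes>\<^bsub>R\<^esub> inv\<^bsub>R\<^esub> (x \<otimes>\<^bsub>R\<^esub> y)) = \<one>\<^bsub>R\<^esub>"
    using m_assoc[OF x y inv] Units_r_inv[OF xy] by (rule trans[OF sym])
  then show xU: "x \<in> Units R"
    using y inv by (intro local_ring_right_inverse[OF loc x]) simp_all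
  have "inv\<^bsub>R\<^esub> x \<otimes>\<^bsub>R\<^esub> (x \<otimes>\<^bsub>R\<^esub> y) = y"
    using x y xU by (simp add: m_assoc[symmetric])
  then show "y \<in> Units R"
    using Units_m_closed[OF Units_inv_Units[OF xU] xy] by (rule subst)
qed

text \<open>The radical is the set of non-units, which absorbs products on both sides because a unit
  product has unit factors.\<close>

lemma local_ring_radical_ideal:
  assumes "local_ring R"
  shows "ideal (jacobson_radical R) R"
proof -
  interpret ring R using assms by (simp add: local_ring_def)
  show ?thesis
    unfolding jacobson_radical_local_ring[OF assms]
  proof (rule idealI[OF ring_axioms])
    show "subgroup (carrier R - Units R) (add_monoid R)"
      using assms by (simp add: local_ring_def additive_subgroup_def)
  next
    fix a x assume "a \<in> carrier R - Units R" and "x \<in> carrier R"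
    then show "x \<otimes>\<^bsub>R\<^esub> a \<in> carrier R - Units R" "a \<otimes>\<^bsub>R\<^esub> x \<in> carrier R - Units R"
      using local_ring_Units_factors(2)[OF assms, of x a] local_ring_Units_factors(1)[OF assms, of a x]
      by auto
  qed
qed

text \<open>Otherwise \<open>1 - j\<close> and \<open>j\<close> would both be non-units, and so
  would their sum 1.\<close>

lemma one_minus_radical_Units:
  assumes "local_ring R" and j: "j \<in> jacobson_radical R"
  shows "\<one>\<^bsub>R\<^esub> \<ominus>\<^bsub>R\<^esub> j \<in> Units R"
proof (rule ccontr)
  interpret ring R using assms by (simp add: local_ring_def)
  interpret J: ideal "jacobson_radical R" R by (rule local_ring_radical_ideal[OF assms(1)])
  have jR: "j \<in> carrier R" using j J.a_subset by blast
  assume "\<one>\<^bsub>R\<^esub> \<ominus>\<^bsub>R\<^esub> j \<notin> Units R"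
  then have "\<one>\<^bsub>R\<^esub> \<ominus>\<^bsub>R\<^esub> j \<in> jacobson_radical R"
    using jR by (simp add: jacobson_radical_local_ring[OF assms(1)])
  then have "(\<one>\<^bsub>R\<^esub> \<ominus>\<^bsub>R\<^esub> j) \<oplus>\<^bsub>R\<^esub> j \<in> jacobson_radical R" using j by simp
  then show False
    using jR by (simp add: a_minus_def a_assoc l_neg jacobson_radical_local_ring[OF assms(1)])
qed

text \<open>Any \<open>z \<notin> A\<close> that makes \<open>R z + A\<close> as small as possible will do.\<close>

lemma radical_annihilates_mod_left_ideal:
  assumes loc: "local_ring R" and fin: "finite (carrier R)"
    and A: "additive_subgroup A R" and one: "\<one>\<^bsub>R\<^esub> \<notin> A"
    and left: "\<And>r a. \<lbrakk>r \<in> carrier R; a \<in> A\<rbrakk> \<Longrightarrow> r \<otimes>\<^bsub>R\<^esub> a \<in> A"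
  obtains z where "z \<in> carrier R" and "z \<notin> A"
    and "\<And>j. j \<in> jacobson_radical R \<Longrightarrow> j \<otimes>\<^bsub>R\<^esub> z \<in> A"
proof -
  interpret ring R using loc by (simp add: local_ring_def)
  interpret J: ideal "jacobson_radical R" R by (rule local_ring_radical_ideal[OF loc])
  interpret A: additive_subgroup A R by fact
  \<comment> \<open>This is \<open>R z + A\<close>, the left ideal whose cardinality is minimised
    over all \<open>z\<close> outside \<open>A\<close>.\<close>
  define S where "S z = {r \<otimes>\<^bsub>R\<^esub> z \<oplus>\<^bsub>R\<^esub> a | r a. r \<in> carrier R \<and> a \<in> A}" for z
  have AR: "a \<in> carrier R" if "a \<in> A" for a using that A.a_subset by blast
  have "\<exists>z. z \<in> carrier R - A" using one by auto
  then obtain z where z: "z \<in> carrier R" "z \<notin> A"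
    and min: "\<And>y. y \<in> carrier R - A \<Longrightarrow> card (S z) \<le> card (S y)"
    using ex_has_least_nat[of "\<lambda>z. z \<in> carrier R - A" _ "\<lambda>z. card (S z)"] by blast
  have "j \<otimes>\<^bsub>R\<^esub> z \<in> A" if j: "j \<in> jacobson_radical R" for j
  proof (rule ccontr)
    assume nA: "j \<otimes>\<^bsub>R\<^esub> z \<notin> A"
    have jR: "j \<in> carrier R" using j by (rule J.a_Hcarr)
    \<comment> \<open>Since \<open>j z\<close> also lies outside \<open>A\<close>, it competes in
      the minimisation; with this inclusion, minimality of \<open>z\<close> forces equality, so
      \<open>z\<close> itself lies in \<open>R j z + A\<close>.\<close>
    have "S (j \<otimes>\<^bsub>R\<^esub> z) \<subseteq> S z"
    proof
      fix x assume "x \<in> S (j \<otimes>\<^bsub>R\<^esub> z)"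
      then obtain r a where "r \<in> carrier R" "a \<in> A" "x = r \<otimes>\<^bsub>R\<^esub> (j \<otimes>\<^bsub>R\<^esub> z) \<oplus>\<^bsub>R\<^esub> a"
        by (auto simp: S_def)
      then have "r \<otimes>\<^bsub>R\<^esub> j \<in> carrier R \<and> a \<in> A \<and> x = (r \<otimes>\<^bsub>R\<^esub> j) \<otimes>\<^bsub>R\<^esub> z \<oplus>\<^bsub>R\<^esub> a"
        using jR z by (simp add: m_assoc)
      then show "x \<in> S z" unfolding S_def by blast
    qed
    moreover have "finite (S z)"
      by (rule finite_subset[OF _ fin]) (auto simp: S_def z AR)
    ultimately have "S (j \<otimes>\<^bsub>R\<^esub> z) = S z"
      using min[of "j \<otimes>\<^bsub>R\<^esub> z"] nA jR z by (intro card_seteq) auto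
    moreover have "z = \<one>\<^bsub>R\<^esub> \<otimes>\<^bsub>R\<^esub> z \<oplus>\<^bsub>R\<^esub> \<zero>\<^bsub>R\<^esub>" using z by simp
    then have "z \<in> S z" unfolding S_def using A.zero_closed by blast
    ultimately have "z \<in> S (j \<otimes>\<^bsub>R\<^esub> z)" by simp
    then obtain r a where r: "r \<in> carrier R" and a: "a \<in> A"
      and za: "z = r \<otimes>\<^bsub>R\<^esub> (j \<otimes>\<^bsub>R\<^esub> z) \<oplus>\<^bsub>R\<^esub> a"
      by (auto simp: S_def)
    \<comment> \<open>The equation for \<open>z\<close> becomes \<open>(1 - r j) z = a\<close>. As
      \<open>r j\<close> is in the radical, the factor is a unit, and cancelling it puts
      \<open>z\<close> into \<open>A\<close>.\<close>
    let ?u = "\<one>\<^bsub>R\<^esub> \<ominus>\<^bsub>R\<^esub> r \<otimes>\<^bsub>R\<^esub> j"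
    have u: "?u \<in> Units R"
      using J.I_l_closed[OF j r] by (rule one_minus_radical_Units[OF loc])
    have "?u \<otimes>\<^bsub>R\<^esub> z = z \<ominus>\<^bsub>R\<^esub> r \<otimes>\<^bsub>R\<^esub> (j \<otimes>\<^bsub>R\<^esub> z)"
      using r jR z by (simp add: a_minus_def l_distr l_minus m_assoc)
    also have "\<dots> = a"
      using r jR z AR[OF a] by (subst za) (simp add: add_minus_cancel)
    finally have "inv\<^bsub>R\<^esub> ?u \<otimes>\<^bsub>R\<^esub> a = inv\<^bsub>R\<^esub> ?u \<otimes>\<^bsub>R\<^esub> (?u \<otimes>\<^bsub>R\<^esub> z)" by simp
    also have "\<dots> = z"
      using u z by (metis Units_closed Units_inv_closed Units_l_inv l_one m_assoc)
    finally show False using left[of "inv\<^bsub>R\<^esub> ?u" a] a z u by simp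
  qed
  with z show ?thesis by (rule that)
qed

text \<open>The hypothesis on \<open>L\<close> says \<open>N \<subseteq> K + N J\<close>. The scalars \<open>r\<close> with \<open>N r \<subseteq> K\<close> form a left
  ideal \<open>A\<close>; if \<open>z \<notin> A\<close> and \<open>J z \<subseteq> A\<close>, then \<open>N z \<subseteq> K z + N J z \<subseteq> K\<close>, a contradiction.\<close>

lemma (in right_module) nakayama:
  assumes loc: "local_ring R" and fin: "finite (carrier R)"
    and K: "submodule K R M" and N: "submodule N R M"
    and cover: "\<And>L. \<lbrakk>additive_subgroup L M; K \<subseteq> L;
      \<And>x j. \<lbrakk>x \<in> N; j \<in> jacobson_radical R\<rbrakk> \<Longrightarrow> j \<odot>\<^bsub>M\<^esub> x \<in> L\<rbrakk> \<Longrightarrow> N \<subseteq> L"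
  shows "N \<subseteq> K"
proof -
  interpret J: ideal "jacobson_radical R" R by (rule local_ring_radical_ideal[OF loc])
  define A where "A = {r \<in> carrier R. \<forall>x\<in>N. r \<odot>\<^bsub>M\<^esub> x \<in> K}"
  have NM: "x \<in> carrier M" if "x \<in> N" for x using that submoduleD(1)[OF N] by blast
  have KM: "x \<in> carrier M" if "x \<in> K" for x using that submoduleD(1)[OF K] by blast
  \<comment> \<open>Membership of 1 in \<open>A\<close> is exactly the inclusion of \<open>N\<close>
    in \<open>K\<close>.\<close>
  have "\<one>\<^bsub>R\<^esub> \<in> A"
  proof (rule ccontr)
    assume one: "\<one>\<^bsub>R\<^esub> \<notin> A"
    have A: "additive_subgroup A R"
      by (rule R.additive_subgroupI)
        (use NM submoduleD(1-3,5)[OF K] submoduleD(5)[OF K, of "\<ominus>\<^bsub>R\<^esub> \<one>\<^bsub>R\<^esub>"] KM in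
          \<open>auto simp: A_def smult_l_null smult_scalar_distr smult_l_minus smult_one\<close>)
    have left: "r \<otimes>\<^bsub>R\<^esub> a \<in> A" if "r \<in> carrier R" "a \<in> A" for r a
      using that NM submoduleD(5)[OF N] by (auto simp: A_def smult_assoc)
    obtain z where z: "z \<in> carrier R" "z \<notin> A"
      and Jz: "\<And>j. j \<in> jacobson_radical R \<Longrightarrow> j \<otimes>\<^bsub>R\<^esub> z \<in> A"
      using radical_annihilates_mod_left_ideal[OF loc fin A one left] by blast
    \<comment> \<open>The preimage of \<open>K\<close> under scaling by \<open>z\<close>. Over a
      noncommutative ring this scaling is additive but need not be linear, which is why
      \<open>cover\<close> is stated for additive subgroups and not for submodules.\<close>
    define L where "L = {y \<in> carrier M. z \<odot>\<^bsub>M\<^esub> y \<in> K}"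
    have "additive_subgroup L M"
      by (rule M.additive_subgroupI)
        (use z submoduleD(1-3)[OF K] submoduleD(5)[OF K, of "\<ominus>\<^bsub>R\<^esub> \<one>\<^bsub>R\<^esub>"] KM in
          \<open>auto simp: L_def smult_r_null smult_vector_distr smult_r_minus smult_l_minus smult_one\<close>)
    moreover have "K \<subseteq> L" using KM z submoduleD(5)[OF K] by (auto simp: L_def)
    \<comment> \<open>Scaling \<open>x\<close> by \<open>j\<close> and then by \<open>z\<close> is
      scaling by \<open>j z\<close>, an element of \<open>A\<close>.\<close>
    moreover have "j \<odot>\<^bsub>M\<^esub> x \<in> L" if "x \<in> N" "j \<in> jacobson_radical R" for x j
      using that NM z Jz[OF that(2)] J.a_Hcarr[OF that(2)]
      by (auto simp: L_def A_def smult_closed smult_assoc)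
    ultimately have "N \<subseteq> L" by (rule cover)
    then have "z \<in> A" using z by (auto simp: L_def A_def)
    then show False using z by simp
  qed
  then show ?thesis using NM by (auto simp: A_def smult_one)
qed

text \<open>Choose a nonzero \<open>z\<close> with \<open>J z = 0\<close>. Scaling by
  \<open>z\<close> kills \<open>h a\<close>, hence kills \<open>a\<close> by injectivity. A unit
  entry of \<open>a\<close> could be cancelled and would give \<open>z = 0\<close>, so all entries
  are non-units.\<close>

lemma injective_rmod_hom_reflects_radical:
  assumes loc: "local_ring R" and fin: "finite (carrier R)"
    and h: "h \<in> rmod_hom R (power_module R t) (power_module R n)"
    and inj: "inj_on h ({..<t} \<rightarrow>\<^sub>E carrier R)"
    and a: "a \<in> {..<t} \<rightarrow>\<^sub>E carrier R" and ha: "h a \<in> {..<n} \<rightarrow>\<^sub>E jacobson_radical R"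
  shows "a \<in> {..<t} \<rightarrow>\<^sub>E jacobson_radical R"
proof -
  interpret ring R using loc by (simp add: local_ring_def)
  interpret J: ideal "jacobson_radical R" R by (rule local_ring_radical_ideal[OF loc])
  \<comment> \<open>Zero belongs to the radical and is therefore a non-unit, unlike 1.\<close>
  have "\<one>\<^bsub>R\<^esub> \<notin> {\<zero>\<^bsub>R\<^esub>}"
    using J.zero_closed Units_one_closed by (metis DiffD2 jacobson_radical_local_ring[OF loc] singletonD)
  moreover have "additive_subgroup {\<zero>\<^bsub>R\<^esub>} R" by (intro additive_subgroupI) auto
  ultimately obtain z where z: "z \<in> carrier R" "z \<noteq> \<zero>\<^bsub>R\<^esub>"
    and Jz: "\<And>j. j \<in> jacobson_radical R \<Longrightarrow> j \<otimes>\<^bsub>R\<^esub> z = \<zero>\<^bsub>R\<^esub>"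
    using radical_annihilates_mod_left_ideal[OF loc fin, of "{\<zero>\<^bsub>R\<^esub>}"] by auto
  interpret T: right_module R "power_module R t" by (rule right_module_power_module)
  have "z \<odot>\<^bsub>power_module R n\<^esub> h a = \<zero>\<^bsub>power_module R n\<^esub>"
    using Jz PiE_mem[OF ha] by (auto intro!: restrict_ext)
  also have "\<dots> = h \<zero>\<^bsub>power_module R t\<^esub>"
    using rmod_hom_zero[OF right_module_power_module right_module_power_module h] by simp
  finally have "h (z \<odot>\<^bsub>power_module R t\<^esub> a) = h \<zero>\<^bsub>power_module R t\<^esub>"
    using rmod_homD(3)[OF h z(1)] a by simp
  moreover have "z \<odot>\<^bsub>power_module R t\<^esub> a \<in> {..<t} \<rightarrow>\<^sub>E carrier R"
    using T.smult_closed[OF z(1), of a] a by simp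
  ultimately have za: "z \<odot>\<^bsub>power_module R t\<^esub> a = \<zero>\<^bsub>power_module R t\<^esub>"
    using inj_onD[OF inj] T.M.zero_closed by (metis power_module_simps(1))
  have "a i \<in> jacobson_radical R" if i: "i < t" for i
  proof -
    have ai: "a i \<in> carrier R" using PiE_mem[OF a, of i] i by simp
    have aiz: "a i \<otimes>\<^bsub>R\<^esub> z = \<zero>\<^bsub>R\<^esub>" using fun_cong[OF za, of i] i by simp
    have "a i \<notin> Units R"
      using Units_l_cancel[of "a i" z "\<zero>\<^bsub>R\<^esub>"] aiz ai z by auto
    then show ?thesis using ai by (simp add: jacobson_radical_local_ring[OF loc])
  qed
  then show ?thesis using a by (auto simp: PiE_iff)
qed


section \<open>Reduction modulo the radical\<close>

context
  fixes R :: "('a, 'r) ring_scheme" and n :: nat and J Q P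
  assumes loc: "local_ring R"
  defines "J \<equiv> jacobson_radical R" and "Q \<equiv> R Quot J" and "P \<equiv> power_module R n"
begin

interpretation ring R using loc by (simp add: local_ring_def)

interpretation J: ideal J R unfolding J_def by (rule local_ring_radical_ideal[OF loc])

interpretation \<pi>: ring_hom_ring R Q "(+>\<^bsub>R\<^esub>) J" unfolding Q_def by (rule J.rcos_ring_hom_ring)

interpretation P: right_module R P unfolding P_def by (rule right_module_power_module)

interpretation PQ: right_module Q "power_module Q n" by (rule \<pi>.S.right_module_power_module)

lemma entry_closed: "x \<in> carrier P \<Longrightarrow> i < n \<Longrightarrow> x i \<in> carrier R"
  using PiE_mem[of x "{..<n}" "\<lambda>_. carrier R" i] by (simp add: P_def)

lemma residue_map_apply: "i < n \<Longrightarrow> residue_map R n x i = J +>\<^bsub>R\<^esub> x i"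
  by (simp add: residue_map_def J_def)

lemma residue_map_closed:
  assumes "x \<in> carrier P"
  shows "residue_map R n x \<in> carrier (power_module Q n)"
  unfolding power_module_simps residue_map_def J_def[symmetric] restrict_PiE_iff
  by (intro ballI \<pi>.hom_closed entry_closed[OF assms]) (simp only: lessThan_iff)

lemma residue_map_add:
  assumes "x \<in> carrier P" and "y \<in> carrier P"
  shows "residue_map R n (x \<oplus>\<^bsub>P\<^esub> y) = residue_map R n x \<oplus>\<^bsub>power_module Q n\<^esub> residue_map R n y"
  using entry_closed[OF assms(1)] entry_closed[OF assms(2)]
  by (auto simp: residue_map_def P_def J_def[symmetric] intro!: restrict_ext)

lemma residue_map_smult:
  assumes "r \<in> carrier R" and "x \<in> carrier P"
  shows "residue_map R n (r \<odot>\<^bsub>P\<^esub> x) = (J +>\<^bsub>R\<^esub> r) \<odot>\<^bsub>power_module Q n\<^esub> residue_map R n x"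
  using entry_closed[OF assms(2)] assms(1)
  by (auto simp: residue_map_def P_def J_def[symmetric] intro!: restrict_ext)

lemma residue_class_exists: "X \<in> carrier Q \<Longrightarrow> \<exists>r\<in>carrier R. X = J +>\<^bsub>R\<^esub> r"
  unfolding Q_def FactRing_def A_RCOSETS_def' by simp

lemma residue_map_surj:
  assumes X: "X \<in> carrier (power_module Q n)"
  shows "\<exists>x\<in>carrier P. residue_map R n x = X"
proof -
  have "\<forall>i\<in>{..<n}. \<exists>r\<in>carrier R. X i = J +>\<^bsub>R\<^esub> r"
    using PiE_mem[of X "{..<n}" "\<lambda>_. carrier Q"] X residue_class_exists by simp
  then obtain r where r: "\<forall>i\<in>{..<n}. r i \<in> carrier R \<and> X i = J +>\<^bsub>R\<^esub> r i"
    by metis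
  let ?x = "restrict r {..<n}"
  have x: "?x \<in> carrier P" using r by (simp add: P_def)
  moreover have "residue_map R n ?x = X"
    using residue_map_closed[OF x] X r
    by (intro power_module_eqI[where n = n and A = "carrier Q" and B = "carrier Q"])
      (simp_all add: residue_map_apply)
  ultimately show ?thesis by blast
qed

text \<open>Two cosets agree iff their difference is zero in the quotient, and the zero of the
  quotient is the coset \<open>J\<close> itself.\<close>

lemma residue_class_eq_iff:
  assumes a: "a \<in> carrier R" and b: "b \<in> carrier R"
  shows "J +>\<^bsub>R\<^esub> a = J +>\<^bsub>R\<^esub> b \<longleftrightarrow> a \<ominus>\<^bsub>R\<^esub> b \<in> J"
proof -
  have zero: "\<zero>\<^bsub>Q\<^esub> = J" unfolding Q_def FactRing_def by (rule ring.simps(1))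
  have "J +>\<^bsub>R\<^esub> a = J +>\<^bsub>R\<^esub> b \<longleftrightarrow> (J +>\<^bsub>R\<^esub> a) \<ominus>\<^bsub>Q\<^esub> (J +>\<^bsub>R\<^esub> b) = \<zero>\<^bsub>Q\<^esub>"
    using \<pi>.S.minus_eq_zero_iff[OF \<pi>.hom_closed[OF a] \<pi>.hom_closed[OF b]] by (rule sym)
  also have "(J +>\<^bsub>R\<^esub> a) \<ominus>\<^bsub>Q\<^esub> (J +>\<^bsub>R\<^esub> b) = J +>\<^bsub>R\<^esub> (a \<ominus>\<^bsub>R\<^esub> b)"
    using a b by (simp add: a_minus_def)
  also have "\<dots> = \<zero>\<^bsub>Q\<^esub> \<longleftrightarrow> a \<ominus>\<^bsub>R\<^esub> b \<in> J"
    unfolding zero using a b J.a_rcos_const J.a_rcos_self[of "a \<ominus>\<^bsub>R\<^esub> b"] by auto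
  finally show ?thesis .
qed

text \<open>The kernel of reduction is \<open>J^n\<close>. Through this fact, conditions on the
  reduced codes become congruences in \<open>R^n\<close>.\<close>

lemma residue_map_eq_iff:
  assumes x: "x \<in> carrier P" and y: "y \<in> carrier P"
  shows "residue_map R n x = residue_map R n y \<longleftrightarrow> x \<ominus>\<^bsub>P\<^esub> y \<in> {..<n} \<rightarrow>\<^sub>E J"
proof -
  have "residue_map R n x = residue_map R n y \<longleftrightarrow> (\<forall>i<n. J +>\<^bsub>R\<^esub> x i = J +>\<^bsub>R\<^esub> y i)"
    by (auto simp: residue_map_def J_def[symmetric] fun_eq_iff)
  also have "\<dots> \<longleftrightarrow> (\<forall>i<n. (x \<ominus>\<^bsub>P\<^esub> y) i \<in> J)"
    using residue_class_eq_iff[OF entry_closed[OF x] entry_closed[OF y]]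
      power_module_minus_apply[of x n y] x y by (simp add: P_def)
  also have "\<dots> \<longleftrightarrow> x \<ominus>\<^bsub>P\<^esub> y \<in> {..<n} \<rightarrow>\<^sub>E J"
    using P.M.minus_closed[OF x y] by (auto simp: P_def PiE_iff)
  finally show ?thesis .
qed

lemma residue_map_zero: "residue_map R n \<zero>\<^bsub>P\<^esub> = \<zero>\<^bsub>power_module Q n\<^esub>"
  by (auto simp: residue_map_def P_def J_def[symmetric] intro!: restrict_ext)

section \<open>Reduced codes and their complementarity, expressed in \<open>R^n\<close>\<close>

lemma linear_code_residue_map:
  assumes "linear_code R n C"
  shows "linear_code Q n (residue_map R n ` C)"
proof -
  have C: "submodule C R P" using assms by (simp add: linear_code_def P_def)
  have CP: "x \<in> carrier P" if "x \<in> C" for x using that P.submoduleD(1)[OF C] by blast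
  show ?thesis
    unfolding linear_code_def
  proof (rule PQ.submoduleI)
    show "residue_map R n ` C \<subseteq> carrier (power_module Q n)"
      using CP residue_map_closed by blast
    show "\<zero>\<^bsub>power_module Q n\<^esub> \<in> residue_map R n ` C"
      using P.submoduleD(2)[OF C] residue_map_zero by (metis imageI)
    show "X \<oplus>\<^bsub>power_module Q n\<^esub> Y \<in> residue_map R n ` C"
      if XY: "X \<in> residue_map R n ` C" "Y \<in> residue_map R n ` C" for X Y
    proof -
      obtain x y where "x \<in> C" "X = residue_map R n x" "y \<in> C" "Y = residue_map R n y"
        using XY by blast
      then show ?thesis
        using residue_map_add[of x y] CP P.submoduleD(3)[OF C, of x y] by (metis imageI)
    qed
    show "r \<odot>\<^bsub>power_module Q n\<^esub> X \<in> residue_map R n ` C"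
      if r: "r \<in> carrier Q" and X: "X \<in> residue_map R n ` C" for r X
    proof -
      obtain x s where "x \<in> C" "X = residue_map R n x" "s \<in> carrier R" "r = J +>\<^bsub>R\<^esub> s"
        using X residue_class_exists[OF r] by blast
      then show ?thesis
        using residue_map_smult[of s x] CP P.submoduleD(5)[OF C, of s x] by (metis imageI)
    qed
  qed
qed

text \<open>Reduction is additive and surjective with kernel \<open>J^n\<close>, so the reduced
  codes span iff \<open>C + D + J^n\<close> is all of \<open>R^n\<close>.\<close>

lemma residue_sum_iff:
  assumes C: "C \<subseteq> carrier P" and D: "D \<subseteq> carrier P"
  shows "residue_map R n ` C <+>\<^bsub>power_module Q n\<^esub> residue_map R n ` D = carrier (power_module Q n)
    \<longleftrightarrow> (\<forall>x\<in>carrier P. \<exists>c\<in>C. \<exists>d\<in>D. x \<ominus>\<^bsub>P\<^esub> (c \<oplus>\<^bsub>P\<^esub> d) \<in> {..<n} \<rightarrow>\<^sub>E J)"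
proof -
  let ?\<pi> = "residue_map R n" and ?PQ = "power_module Q n"
  have CP: "c \<in> carrier P" if "c \<in> C" for c using that C by blast
  have DP: "d \<in> carrier P" if "d \<in> D" for d using that D by blast
  have sum: "?\<pi> ` C <+>\<^bsub>?PQ\<^esub> ?\<pi> ` D = (\<Union>c\<in>C. \<Union>d\<in>D. {?\<pi> (c \<oplus>\<^bsub>P\<^esub> d)})"
    unfolding set_add_def' image_image by (intro SUP_cong refl) (simp only: residue_map_add[OF CP DP])
  have PQ: "carrier ?PQ = ?\<pi> ` carrier P"
    using residue_map_surj residue_map_closed by blast
  have "?\<pi> (c \<oplus>\<^bsub>P\<^esub> d) \<in> carrier ?PQ" if "c \<in> C" "d \<in> D" for c d
    using that by (intro residue_map_closed P.M.a_closed CP DP)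
  then have "?\<pi> ` C <+>\<^bsub>?PQ\<^esub> ?\<pi> ` D \<subseteq> carrier ?PQ"
    unfolding sum UN_subset_iff by blast
  then have "?\<pi> ` C <+>\<^bsub>?PQ\<^esub> ?\<pi> ` D = carrier ?PQ \<longleftrightarrow>
      carrier ?PQ \<subseteq> ?\<pi> ` C <+>\<^bsub>?PQ\<^esub> ?\<pi> ` D"
    by (simp only: set_eq_subset) simp
  also have "\<dots> \<longleftrightarrow> (\<forall>x\<in>carrier P. ?\<pi> x \<in> ?\<pi> ` C <+>\<^bsub>?PQ\<^esub> ?\<pi> ` D)"
    unfolding PQ by (rule image_subset_iff)
  also have "\<dots> \<longleftrightarrow> (\<forall>x\<in>carrier P. \<exists>c\<in>C. \<exists>d\<in>D. ?\<pi> x = ?\<pi> (c \<oplus>\<^bsub>P\<^esub> d))"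
    unfolding sum by blast
  also have "\<dots> \<longleftrightarrow> (\<forall>x\<in>carrier P. \<exists>c\<in>C. \<exists>d\<in>D. x \<ominus>\<^bsub>P\<^esub> (c \<oplus>\<^bsub>P\<^esub> d) \<in> {..<n} \<rightarrow>\<^sub>E J)"
    by (intro ball_cong bex_cong refl residue_map_eq_iff) (simp_all add: CP DP)
  finally show ?thesis .
qed

text \<open>A common element of the reduced codes is given by codewords \<open>c\<close> and
  \<open>d\<close> congruent modulo \<open>J^n\<close>; it is zero iff \<open>c\<close> lies in
  \<open>J^n\<close>.\<close>

lemma residue_inter_iff:
  assumes C: "linear_code R n C" and D: "linear_code R n D"
  shows "residue_map R n ` C \<inter> residue_map R n ` D = {\<zero>\<^bsub>power_module Q n\<^esub>}
    \<longleftrightarrow> (\<forall>c\<in>C. \<forall>d\<in>D. c \<ominus>\<^bsub>P\<^esub> d \<in> {..<n} \<rightarrow>\<^sub>E J \<longrightarrow> c \<in> {..<n} \<rightarrow>\<^sub>E J)"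
proof -
  let ?\<pi> = "residue_map R n"
  have C': "submodule C R P" and D': "submodule D R P"
    using C D by (simp_all add: linear_code_def P_def)
  have CP: "c \<in> carrier P" if "c \<in> C" for c using that P.submoduleD(1)[OF C'] by blast
  have DP: "d \<in> carrier P" if "d \<in> D" for d using that P.submoduleD(1)[OF D'] by blast
  have eq0: "?\<pi> c = \<zero>\<^bsub>power_module Q n\<^esub> \<longleftrightarrow> c \<in> {..<n} \<rightarrow>\<^sub>E J" if "c \<in> C" for c
    using residue_map_eq_iff[OF CP[OF that] P.M.zero_closed] CP[OF that] P.M.add.inv_one
    by (simp add: residue_map_zero a_minus_def a_inv_def del: power_module_simps)
  have "\<zero>\<^bsub>power_module Q n\<^esub> \<in> ?\<pi> ` C \<inter> ?\<pi> ` D"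
    using P.submoduleD(2)[OF C'] P.submoduleD(2)[OF D'] residue_map_zero by (metis IntI imageI)
  then have "?\<pi> ` C \<inter> ?\<pi> ` D = {\<zero>\<^bsub>power_module Q n\<^esub>} \<longleftrightarrow>
      (\<forall>c\<in>C. \<forall>d\<in>D. ?\<pi> c = ?\<pi> d \<longrightarrow> ?\<pi> c = \<zero>\<^bsub>power_module Q n\<^esub>)"
    by blast
  also have "\<dots> \<longleftrightarrow> (\<forall>c\<in>C. \<forall>d\<in>D. c \<ominus>\<^bsub>P\<^esub> d \<in> {..<n} \<rightarrow>\<^sub>E J \<longrightarrow> c \<in> {..<n} \<rightarrow>\<^sub>E J)"
    using eq0 residue_map_eq_iff CP DP by (metis (no_types, lifting))
  finally show ?thesis .
qed

section \<open>The two implications\<close>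

lemma rmod_hom_radical_image:
  assumes f: "f \<in> rmod_hom R P P" and fN: "\<And>x. x \<in> carrier P \<Longrightarrow> f x \<in> N"
    and L: "additive_subgroup L P" and NJ: "\<And>x j. \<lbrakk>x \<in> N; j \<in> J\<rbrakk> \<Longrightarrow> j \<odot>\<^bsub>P\<^esub> x \<in> L"
    and a: "a \<in> {..<n} \<rightarrow>\<^sub>E J"
  shows "f a \<in> L"
proof (rule rmod_hom_power_module_image[OF P.right_module_axioms _ _ J.a_subset L NJ a])
  show "f \<in> rmod_hom R (power_module R n) P" using f by (simp only: P_def)
  show "f x \<in> N" if "x \<in> {..<n} \<rightarrow>\<^sub>E carrier R" for x using fN[of x] that by (simp add: P_def)
qed

lemma LCP_imp_LCP_residue_map:
  assumes CD: "LCP R n C D"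
  shows "LCP Q n (residue_map R n ` C) (residue_map R n ` D)"
proof -
  have C: "linear_code R n C" and D: "linear_code R n D"
    and sum: "C <+>\<^bsub>P\<^esub> D = carrier P" and int: "C \<inter> D = {\<zero>\<^bsub>P\<^esub>}"
    using CD by (simp_all add: LCP_def P_def)
  have C': "submodule C R P" and D': "submodule D R P"
    using C D by (simp_all add: linear_code_def P_def)
  have CP: "c \<in> carrier P" if "c \<in> C" for c using that P.submoduleD(1)[OF C'] by blast
  have DP: "d \<in> carrier P" if "d \<in> D" for d using that P.submoduleD(1)[OF D'] by blast
  have zero: "\<zero>\<^bsub>P\<^esub> \<in> {..<n} \<rightarrow>\<^sub>E J" by (simp add: P_def)
  have JJ: "additive_subgroup ({..<n} \<rightarrow>\<^sub>E J) P"
  proof -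
    have "submodule ({..<n} \<rightarrow>\<^sub>E J) R P"
    proof (rule P.submoduleI)
      show "{..<n} \<rightarrow>\<^sub>E J \<subseteq> carrier P"
        unfolding P_def power_module_simps using J.a_subset by (intro PiE_mono)
      show "x \<oplus>\<^bsub>P\<^esub> y \<in> {..<n} \<rightarrow>\<^sub>E J" if "x \<in> {..<n} \<rightarrow>\<^sub>E J" "y \<in> {..<n} \<rightarrow>\<^sub>E J" for x y
        using PiE_mem[OF that(1)] PiE_mem[OF that(2)] by (simp add: P_def)
      show "r \<odot>\<^bsub>P\<^esub> x \<in> {..<n} \<rightarrow>\<^sub>E J" if "r \<in> carrier R" "x \<in> {..<n} \<rightarrow>\<^sub>E J" for r x
        using PiE_mem[OF that(2)] that(1) J.I_r_closed by (simp add: P_def)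
    qed (rule zero)
    then show ?thesis by (rule P.submodule_imp_additive_subgroup)
  qed
  obtain p where p: "p \<in> rmod_hom R P P"
    and pC: "\<And>x. x \<in> carrier P \<Longrightarrow> p x \<in> C"
    and pD: "\<And>x. x \<in> carrier P \<Longrightarrow> x \<ominus>\<^bsub>P\<^esub> p x \<in> D"
    using power_module_projection_exists[OF C D] sum
    unfolding P_def[symmetric] power_module_simps(1)[of R n, folded P_def, symmetric] by blast
  \<comment> \<open>The image lemma with the whole module as \<open>N\<close> and \<open>J^n\<close>
    as \<open>L\<close>; the required products lie in \<open>J^n\<close> because \<open>J\<close>
    absorbs multiplication from the left.\<close>
  have p_radical: "p x \<in> {..<n} \<rightarrow>\<^sub>E J" if "x \<in> {..<n} \<rightarrow>\<^sub>E J" for x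
  proof (rule rmod_hom_radical_image[OF p _ JJ _ that])
    show "p y \<in> carrier P" if "y \<in> carrier P" for y using rmod_homD(1)[OF p that] .
    show "j \<odot>\<^bsub>P\<^esub> y \<in> {..<n} \<rightarrow>\<^sub>E J" if "y \<in> carrier P" "j \<in> J" for y j
      using entry_closed[OF that(1)] that(2) J.I_l_closed by (simp add: P_def)
  qed
  have p_minus: "p (c \<ominus>\<^bsub>P\<^esub> d) = c" if c: "c \<in> C" and d: "d \<in> D" for c d
  proof -
    let ?x = "c \<ominus>\<^bsub>P\<^esub> d"
    have x: "?x \<in> carrier P" using CP[OF c] DP[OF d] by (rule P.M.minus_closed)
    \<comment> \<open>The left side is a difference of elements of \<open>C\<close>, the right side
      a sum of elements of \<open>D\<close>; the trivial intersection makes both zero.\<close>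
    have "c \<ominus>\<^bsub>P\<^esub> p ?x = d \<oplus>\<^bsub>P\<^esub> (?x \<ominus>\<^bsub>P\<^esub> p ?x)"
      using CP[OF c] DP[OF d] CP[OF pC[OF x]]
      by (simp add: a_minus_def P.M.a_ac P.M.r_neg1 P.M.r_neg2)
    then have "c \<ominus>\<^bsub>P\<^esub> p ?x \<in> C \<inter> D"
      using P.submoduleD(4)[OF C' c pC[OF x]] P.submoduleD(3)[OF D' d pD[OF x]] by simp
    then show ?thesis
      using int P.M.minus_eq_zero_iff[OF CP[OF c] CP[OF pC[OF x]]] by simp
  qed
  have "residue_map R n ` C \<inter> residue_map R n ` D = {\<zero>\<^bsub>power_module Q n\<^esub>}"
    unfolding residue_inter_iff[OF C D] using p_radical p_minus by metis
  moreover have "residue_map R n ` C <+>\<^bsub>power_module Q n\<^esub> residue_map R n ` D =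
      carrier (power_module Q n)"
    unfolding residue_sum_iff[OF P.submoduleD(1)[OF C'] P.submoduleD(1)[OF D']]
  proof
    fix x assume x: "x \<in> carrier P"
    then obtain c d where cd: "c \<in> C" "d \<in> D" and "x = c \<oplus>\<^bsub>P\<^esub> d"
      unfolding sum[symmetric] set_add_def' by blast
    then have "x \<ominus>\<^bsub>P\<^esub> (c \<oplus>\<^bsub>P\<^esub> d) \<in> {..<n} \<rightarrow>\<^sub>E J"
      using P.M.minus_eq_zero_iff[OF x x] zero by simp
    with cd show "\<exists>c\<in>C. \<exists>d\<in>D. x \<ominus>\<^bsub>P\<^esub> (c \<oplus>\<^bsub>P\<^esub> d) \<in> {..<n} \<rightarrow>\<^sub>E J" by blast
  qed
  ultimately show ?thesis
    unfolding LCP_def using linear_code_residue_map[OF C] linear_code_residue_map[OF D] by blast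
qed

lemma LCP_residue_map_imp_LCP:
  assumes fin: "finite (carrier R)"
    and free_C: "free_code R n C" and free_D: "free_code R n D"
    and CD: "LCP Q n (residue_map R n ` C) (residue_map R n ` D)"
  shows "LCP R n C D"
proof -
  have C: "linear_code R n C" and D: "linear_code R n D"
    using free_C free_D by (simp_all add: free_code_def)
  have C': "submodule C R P" and D': "submodule D R P"
    using C D by (simp_all add: linear_code_def P_def)
  have CP: "c \<in> carrier P" if "c \<in> C" for c using that P.submoduleD(1)[OF C'] by blast
  have DP: "d \<in> carrier P" if "d \<in> D" for d using that P.submoduleD(1)[OF D'] by blast
  have cover: "\<exists>c\<in>C. \<exists>d\<in>D. x \<ominus>\<^bsub>P\<^esub> (c \<oplus>\<^bsub>P\<^esub> d) \<in> {..<n} \<rightarrow>\<^sub>E J" if "x \<in> carrier P" for x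
    using CD residue_sum_iff[OF P.submoduleD(1)[OF C'] P.submoduleD(1)[OF D']] that
    unfolding LCP_def by blast
  have radical: "c \<in> {..<n} \<rightarrow>\<^sub>E J"
    if "c \<in> C" "d \<in> D" "c \<ominus>\<^bsub>P\<^esub> d \<in> {..<n} \<rightarrow>\<^sub>E J" for c d
    using CD residue_inter_iff[OF C D] that unfolding LCP_def by blast
  have sumI: "c \<oplus>\<^bsub>P\<^esub> d \<in> C <+>\<^bsub>P\<^esub> D" if "c \<in> C" "d \<in> D" for c d
    using that unfolding set_add_def' by blast
  have sumE: "\<exists>c\<in>C. \<exists>d\<in>D. x = c \<oplus>\<^bsub>P\<^esub> d" if "x \<in> C <+>\<^bsub>P\<^esub> D" for x
    using that unfolding set_add_def' by blast
  have K: "submodule (C <+>\<^bsub>P\<^esub> D) R P"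
  proof (rule P.submoduleI)
    show "C <+>\<^bsub>P\<^esub> D \<subseteq> carrier P"
      using sumE CP DP P.M.a_closed by (intro subsetI) metis
    show "\<zero>\<^bsub>P\<^esub> \<in> C <+>\<^bsub>P\<^esub> D"
      using sumI[OF P.submoduleD(2)[OF C'] P.submoduleD(2)[OF D']] by simp
  next
    fix x y assume "x \<in> C <+>\<^bsub>P\<^esub> D" and "y \<in> C <+>\<^bsub>P\<^esub> D"
    then obtain c d c' d' where cd: "c \<in> C" "d \<in> D" "c' \<in> C" "d' \<in> D"
      and xy: "x = c \<oplus>\<^bsub>P\<^esub> d" "y = c' \<oplus>\<^bsub>P\<^esub> d'"
      using sumE[of x] sumE[of y] by blast
    have "x \<oplus>\<^bsub>P\<^esub> y = (c \<oplus>\<^bsub>P\<^esub> c') \<oplus>\<^bsub>P\<^esub> (d \<oplus>\<^bsub>P\<^esub> d')"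
      using CP[OF cd(1)] DP[OF cd(2)] CP[OF cd(3)] DP[OF cd(4)] by (simp add: xy P.M.a_ac)
    then show "x \<oplus>\<^bsub>P\<^esub> y \<in> C <+>\<^bsub>P\<^esub> D"
      using sumI[OF P.submoduleD(3)[OF C' cd(1,3)] P.submoduleD(3)[OF D' cd(2,4)]] by simp
  next
    fix r x assume r: "r \<in> carrier R" and "x \<in> C <+>\<^bsub>P\<^esub> D"
    then obtain c d where cd: "c \<in> C" "d \<in> D" and x: "x = c \<oplus>\<^bsub>P\<^esub> d"
      using sumE[of x] by blast
    have "r \<odot>\<^bsub>P\<^esub> x = r \<odot>\<^bsub>P\<^esub> c \<oplus>\<^bsub>P\<^esub> r \<odot>\<^bsub>P\<^esub> d"
      unfolding x using r CP[OF cd(1)] DP[OF cd(2)] by (rule P.smult_vector_distr)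
    then show "r \<odot>\<^bsub>P\<^esub> x \<in> C <+>\<^bsub>P\<^esub> D"
      using sumI[OF P.submoduleD(5)[OF C' r cd(1)] P.submoduleD(5)[OF D' r cd(2)]] by simp
  qed
  have whole: "submodule (carrier P) R P"
    by (rule P.submoduleI) (simp_all add: P.smult_closed)
  have id: "(\<lambda>x. x) \<in> rmod_hom R P P" by (simp add: rmod_hom_def)
  \<comment> \<open>Nakayama's lemma with \<open>K = C + D\<close> and the whole module as
    \<open>N\<close>.\<close>
  have "carrier P \<subseteq> C <+>\<^bsub>P\<^esub> D"
  proof (rule P.nakayama[OF loc fin K whole])
    fix L assume L: "additive_subgroup L P" and KL: "C <+>\<^bsub>P\<^esub> D \<subseteq> L"
      and PJ: "\<And>x j. \<lbrakk>x \<in> carrier P; j \<in> jacobson_radical R\<rbrakk> \<Longrightarrow> j \<odot>\<^bsub>P\<^esub> x \<in> L"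
    show "carrier P \<subseteq> L"
    proof
      fix x assume x: "x \<in> carrier P"
      then obtain c d where c: "c \<in> C" and d: "d \<in> D"
        and J: "x \<ominus>\<^bsub>P\<^esub> (c \<oplus>\<^bsub>P\<^esub> d) \<in> {..<n} \<rightarrow>\<^sub>E J"
        using cover by blast
      \<comment> \<open>Applied to the identity map, the image lemma says that \<open>J^n\<close> is
        contained in \<open>R^n J\<close>.\<close>
      have "x \<ominus>\<^bsub>P\<^esub> (c \<oplus>\<^bsub>P\<^esub> d) \<in> L"
        using rmod_hom_radical_image[OF id _ L PJ[folded J_def] J] by simp
      moreover have "c \<oplus>\<^bsub>P\<^esub> d \<in> L"
        using KL sumI[OF c d] by blast
      ultimately have "(x \<ominus>\<^bsub>P\<^esub> (c \<oplus>\<^bsub>P\<^esub> d)) \<oplus>\<^bsub>P\<^esub> (c \<oplus>\<^bsub>P\<^esub> d) \<in> L"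
        by (rule additive_subgroup.a_closed[OF L])
      then show "x \<in> L"
        using x CP[OF c] DP[OF d] by (simp add: a_minus_def P.M.a_assoc P.M.l_neg)
    qed
  qed
  then have sum: "C <+>\<^bsub>P\<^esub> D = carrier P" using P.submoduleD(1)[OF K] by blast
  \<comment> \<open>The sum is not yet known to be direct, so \<open>p\<close> is merely a linear
    choice of a \<open>C\<close>-component and might not fix \<open>C\<close> pointwise.\<close>
  obtain p where p: "p \<in> rmod_hom R P P"
    and pC: "\<And>x. x \<in> carrier P \<Longrightarrow> p x \<in> C"
    and pD: "\<And>x. x \<in> carrier P \<Longrightarrow> x \<ominus>\<^bsub>P\<^esub> p x \<in> D"
    using power_module_projection_exists[OF C D] sum
    unfolding P_def[symmetric] power_module_simps(1)[of R n, folded P_def, symmetric] by blast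
  have q: "(\<lambda>x. x \<ominus>\<^bsub>P\<^esub> p x) \<in> rmod_hom R P P"
    unfolding rmod_hom_def
  proof (intro CollectI conjI ballI Pi_I)
    fix x assume x: "x \<in> carrier P"
    then show "x \<ominus>\<^bsub>P\<^esub> p x \<in> carrier P" by (rule DP[OF pD])
    fix y assume y: "y \<in> carrier P"
    show "x \<oplus>\<^bsub>P\<^esub> y \<ominus>\<^bsub>P\<^esub> p (x \<oplus>\<^bsub>P\<^esub> y) = (x \<ominus>\<^bsub>P\<^esub> p x) \<oplus>\<^bsub>P\<^esub> (y \<ominus>\<^bsub>P\<^esub> p y)"
      using x y CP[OF pC[OF x]] CP[OF pC[OF y]]
      by (simp add: rmod_homD(2)[OF p] a_minus_def P.M.minus_add P.M.a_ac)
  next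
    fix r x assume r: "r \<in> carrier R" and x: "x \<in> carrier P"
    show "r \<odot>\<^bsub>P\<^esub> x \<ominus>\<^bsub>P\<^esub> p (r \<odot>\<^bsub>P\<^esub> x) = r \<odot>\<^bsub>P\<^esub> (x \<ominus>\<^bsub>P\<^esub> p x)"
      using r x CP[OF pC[OF x]]
      by (simp add: rmod_homD(3)[OF p] a_minus_def P.smult_vector_distr P.smult_r_minus)
  qed
  let ?N = "C \<inter> D"
  have N: "submodule ?N R P"
    by (rule P.submoduleI) (use CP P.submoduleD[OF C'] P.submoduleD[OF D'] in auto)
  have zero: "submodule {\<zero>\<^bsub>P\<^esub>} R P"
    by (rule P.submoduleI) (simp_all add: P.smult_r_null)
  have "?N \<subseteq> {\<zero>\<^bsub>P\<^esub>}"
  \<comment> \<open>With \<open>K = 0\<close> the task is to show \<open>N = N J\<close>: every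
    additive subgroup \<open>L\<close> containing the products from \<open>N J\<close> must contain
    \<open>N\<close>.\<close>
  proof (rule P.nakayama[OF loc fin zero N])
    fix L assume L: "additive_subgroup L P"
      and NJ: "\<And>x j. \<lbrakk>x \<in> ?N; j \<in> jacobson_radical R\<rbrakk> \<Longrightarrow> j \<odot>\<^bsub>P\<^esub> x \<in> L"
    \<comment> \<open>For a free code \<open>E\<close>, a codeword in \<open>J^n\<close> has
      coordinates in \<open>J\<close> under the parametrization \<open>h\<close>. The composite of
      \<open>f\<close> and \<open>h\<close> takes values in \<open>N\<close>, so it sends these
      coordinates into \<open>N J\<close>.\<close>
    have in_L: "f x \<in> L"
      if E: "free_code R n E" and f: "f \<in> rmod_hom R P P" and fN: "\<And>e. e \<in> E \<Longrightarrow> f e \<in> ?N"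
        and x: "x \<in> E" "x \<in> {..<n} \<rightarrow>\<^sub>E J" for E f x
    proof -
      obtain t h where h: "h \<in> rmod_hom R (power_module R t) (power_module R n)"
        and bij: "bij_betw h ({..<t} \<rightarrow>\<^sub>E carrier R) E"
        using free_code_parametrization[OF E] .
      obtain a where a: "a \<in> {..<t} \<rightarrow>\<^sub>E carrier R" and xa: "x = h a"
        using bij x(1) by (auto simp: bij_betw_def)
      have aJ: "a \<in> {..<t} \<rightarrow>\<^sub>E J"
        unfolding J_def using bij x(2) xa
        by (intro injective_rmod_hom_reflects_radical[OF loc fin h _ a]) (simp_all add: bij_betw_def J_def)
      have hP: "h \<in> rmod_hom R (power_module R t) P" using h by (simp only: P_def)
      have "(\<lambda>b. f (h b)) \<in> rmod_hom R (power_module R t) P"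
        using rmod_homD[OF f] rmod_homD[OF hP] by (simp add: rmod_hom_def del: power_module_simps)
      moreover have "f (h b) \<in> ?N" if "b \<in> {..<t} \<rightarrow>\<^sub>E carrier R" for b
        using fN that bij by (metis bij_betwE)
      ultimately show ?thesis
        unfolding xa
        by (rule rmod_hom_power_module_image[OF P.right_module_axioms _ _ J.a_subset L NJ[folded J_def] aJ])
    qed
    show "?N \<subseteq> L"
    proof
      fix x assume x: "x \<in> ?N"
      then have xP: "x \<in> carrier P" using CP by blast
      have "x \<ominus>\<^bsub>P\<^esub> x \<in> {..<n} \<rightarrow>\<^sub>E J"
        using P.M.minus_eq_zero_iff[OF xP xP] by (simp add: P_def)
      \<comment> \<open>The congruence condition is used with both codewords equal to
        \<open>x\<close>.\<close>
      then have xJ: "x \<in> {..<n} \<rightarrow>\<^sub>E J" using radical x by blast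
      \<comment> \<open>The complementary map \<open>x - p x\<close> has values in \<open>D\<close>;
        on \<open>C\<close> its values lie in \<open>C\<close> as well.\<close>
      have "c \<ominus>\<^bsub>P\<^esub> p c \<in> ?N" if "c \<in> C" for c
        using that pC pD CP P.submoduleD(4)[OF C'] by blast
      then have "x \<ominus>\<^bsub>P\<^esub> p x \<in> L"
        using x xJ by (intro in_L[OF free_C q]) simp_all
      moreover have "p d \<in> ?N" if d: "d \<in> D" for d
      proof -
        \<comment> \<open>Symmetrically, this writes \<open>p d\<close>, an element of
          \<open>C\<close>, as a difference of elements of \<open>D\<close>.\<close>
        have "d \<ominus>\<^bsub>P\<^esub> (d \<ominus>\<^bsub>P\<^esub> p d) = p d"
          using DP[OF d] CP[OF pC[OF DP[OF d]]]
          by (simp add: a_minus_def P.M.minus_add P.M.r_neg2)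
        then show ?thesis
          using P.submoduleD(4)[OF D' d pD[OF DP[OF d]]] pC[OF DP[OF d]] by simp
      qed
      then have "p x \<in> L"
        using x xJ by (intro in_L[OF free_D p]) simp_all
      \<comment> \<open>Freeness of \<open>C\<close> placed the first summand in \<open>L\<close>,
        freeness of \<open>D\<close> the second; their sum is \<open>x\<close>.\<close>
      ultimately have "(x \<ominus>\<^bsub>P\<^esub> p x) \<oplus>\<^bsub>P\<^esub> p x \<in> L"
        by (rule additive_subgroup.a_closed[OF L])
      then show "x \<in> L"
        using xP CP[OF pC[OF xP]] by (simp add: a_minus_def P.M.a_assoc P.M.l_neg)
    qed
  qed
  then have "?N = {\<zero>\<^bsub>P\<^esub>}" using P.submoduleD(2)[OF N] by blast
  then show ?thesis
    using C D sum by (simp add: LCP_def P_def)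
qed

end

theorem theorem3p7:
  fixes R :: "('a, 'r) ring_scheme" and n :: nat and C D :: "(nat \<Rightarrow> 'a) set"
  assumes "finite_frobenius_ring R" and "local_ring R"
    and "free_code R n C" and "free_code R n D"
  shows "LCP R n C D \<longleftrightarrow>
    LCP (R Quot jacobson_radical R) n (residue_map R n ` C) (residue_map R n ` D)"
proof
  show "LCP (R Quot jacobson_radical R) n (residue_map R n ` C) (residue_map R n ` D)"
    if "LCP R n C D"
    by (rule LCP_imp_LCP_residue_map[OF assms(2) that])
  show "LCP R n C D"
    if "LCP (R Quot jacobson_radical R) n (residue_map R n ` C) (residue_map R n ` D)"
    using assms(1) by (intro LCP_residue_map_imp_LCP[OF assms(2) _ assms(3,4) that])
      (simp add: finite_frobenius_ring_def)
qed

end
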